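(* Let $n \geq 1$ and let $\lambda$ be a partition of $n$. Then for every $\mu \in \mathcal{D}(\lambda)$, $$\sum_{\nu \in \mathcal{U}(\lambda)} \frac{f_\mu f_\nu}{(h_\lambda(c_{\mu,\nu}))^2} = \frac{n+1}{n}\,(f_\lambda)^2,$$ and for every $\nu \in \mathcal{U}(\lambda)$, $$\frac{f_\lambda f_\nu}{n} + \sum_{\mu \in \mathcal{D}(\lambda)} \frac{f_\mu f_\nu}{(h_\lambda(c_{\mu,\nu}))^2} = \frac{n+1}{n}\,(f_\lambda)^2.$$
   Context: A partition $\kappa$ is identified with its Young diagram, the set of cells (row $r$, column $c$) with $r \geq 1$, $1 \le c \le \kappa_r$, drawn in French notation (row 1, of length $\kappa_1$, at the bottom). $f_\kappa$ is the number of standard Young tableaux of shape $\kappa$ (with $f_\emptyset = 1$). Write $\mu \lessdot \lambda$ if $\mu \subseteq \lambda$ and $|\lambda/\mu| = 1$; $\mathcal{D}(\lambda) = \{\mu : \mu \lessdot \lambda\}$ and $\mathcal{U}(\lambda) = \{\nu : \lambda \lessdot \nu\}$. The hook-length of a cell $c \in \lambda$ is $h_\lambda(c) = a_\lambda(c) + \ell_\lambda(c) + 1$, where $a_\lambda(c)$ (resp. $\ell_\lambda(c)$) is the number of cells of $\lambda$ strictly to the right of $c$ in its row (resp. strictly above $c$ in its column). For $\mu \in \mathcal{D}(\lambda)$ and $\nu \in \mathcal{U}(\lambda)$, $c_{\mu,\nu}$ is the unique cell of $\lambda$ that lies either in the row of the cell $\nu/\lambda$ and the column of the cell $\lambda/\mu$,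 or in the column of the cell $\nu/\lambda$ and the row of the cell $\lambda/\mu$. *)

theory Defs
  imports Complex_Main "HOL-Library.FuncSet"
begin

text \<open>A partition is the list of its parts (all positive, weakly decreasing); the part of
  row \<open>r\<close> is \<open>\<kappa> ! (r - 1)\<close>, because rows and columns of cells are numbered from 1.\<close>

definition is_partition :: "nat list \<Rightarrow> bool" where
  "is_partition \<kappa> \<longleftrightarrow> sorted_wrt (\<ge>) \<kappa> \<and> 0 \<notin> set \<kappa>"

definition partition_of :: "nat list \<Rightarrow> nat \<Rightarrow> bool" where
  "partition_of \<kappa> n \<longleftrightarrow> is_partition \<kappa> \<and> sum_list \<kappa> = n"

type_synonym cell = "nat \<times> nat"  \<comment> \<open>(row, column)\<close>

definition young_diagram :: "nat list \<Rightarrow> cell set" where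
  "young_diagram \<kappa> = {(r, c). 1 \<le> r \<and> r \<le> length \<kappa> \<and> 1 \<le> c \<and> c \<le> \<kappa> ! (r - 1)}"

text \<open>Tableaux are functions on the diagram, made extensional (value \<^term>\<open>undefined\<close>
  elsewhere) so that distinct functions are distinct fillings.\<close>

definition standard_tableaux :: "nat list \<Rightarrow> (cell \<Rightarrow> nat) set" where
  "standard_tableaux \<kappa> = {T \<in> extensional (young_diagram \<kappa>).
     bij_betw T (young_diagram \<kappa>) {1..sum_list \<kappa>} \<and>
     (\<forall>r c c'. (r, c) \<in> young_diagram \<kappa> \<longrightarrow> (r, c') \<in> young_diagram \<kappa> \<longrightarrow> c < c' \<longrightarrow>
        T (r, c) < T (r, c')) \<and>
     (\<forall>r r' c. (r, c) \<in> young_diagram \<kappa> \<longrightarrow> (r', c) \<in> young_diagram \<kappa> \<longrightarrow> r < r' \<longrightarrow>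
        T (r, c) < T (r', c))}"

definition num_SYT :: "nat list \<Rightarrow> nat" where
  "num_SYT \<kappa> = card (standard_tableaux \<kappa>)"

definition covered_by :: "nat list \<Rightarrow> nat list \<Rightarrow> bool" (infix "\<lessdot>" 50) where
  "\<mu> \<lessdot> lam \<longleftrightarrow> is_partition \<mu> \<and> is_partition lam \<and> young_diagram \<mu> \<subseteq> young_diagram lam \<and>
     card (young_diagram lam - young_diagram \<mu>) = 1"

definition down_covers :: "nat list \<Rightarrow> nat list set" where
  "down_covers lam = {\<mu>. \<mu> \<lessdot> lam}"

definition up_covers :: "nat list \<Rightarrow> nat list set" where
  "up_covers lam = {\<nu>. lam \<lessdot> \<nu>}"

definition arm :: "nat list \<Rightarrow> cell \<Rightarrow> nat" where
  "arm lam = (\<lambda>(r, c). card {c'. c < c' \<and> (r, c') \<in> young_diagram lam})"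

definition leg :: "nat list \<Rightarrow> cell \<Rightarrow> nat" where
  "leg lam = (\<lambda>(r, c). card {r'. r < r' \<and> (r', c) \<in> young_diagram lam})"

definition hook_length :: "nat list \<Rightarrow> cell \<Rightarrow> nat" where
  "hook_length lam x = arm lam x + leg lam x + 1"

text \<open>The single cell of \<open>lam/\<mu>\<close>, meaningful if \<open>\<mu> \<lessdot> lam\<close>.\<close>

definition skew_cell :: "nat list \<Rightarrow> nat list \<Rightarrow> cell" where
  "skew_cell lam \<mu> = the_elem (young_diagram lam - young_diagram \<mu>)"

definition is_crossing_cell :: "nat list \<Rightarrow> nat list \<Rightarrow> nat list \<Rightarrow> cell \<Rightarrow> bool" where
  "is_crossing_cell lam \<mu> \<nu> x \<longleftrightarrow> x \<in> young_diagram lam \<and>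
     (fst x = fst (skew_cell \<nu> lam) \<and> snd x = snd (skew_cell lam \<mu>) \<or>
      snd x = snd (skew_cell \<nu> lam) \<and> fst x = fst (skew_cell lam \<mu>))"

definition crossing_cell :: "nat list \<Rightarrow> nat list \<Rightarrow> nat list \<Rightarrow> cell" where
  "crossing_cell lam \<mu> \<nu> = (THE x. is_crossing_cell lam \<mu> \<nu> x)"

text \<open>The definite description and the sums over covers are well defined:\<close>

lemma young_diagram_mono:
  assumes "is_partition \<kappa>" "(r, c) \<in> young_diagram \<kappa>" "1 \<le> r'" "r' \<le> r" "1 \<le> c'" "c' \<le> c"
  shows "(r', c') \<in> young_diagram \<kappa>"
proof -
  have "\<kappa> ! (r - 1) \<le> \<kappa> ! (r' - 1)"
  proof (cases "r' = r")
    case False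
    then show ?thesis
      using assms sorted_wrt_nth_less[of "(\<ge>)" \<kappa> "r' - 1" "r - 1"]
      by (auto simp: is_partition_def young_diagram_def)
  qed simp
  then show ?thesis
    using assms by (auto simp: young_diagram_def)
qed

lemma skew_cell_eq:
  assumes "\<mu> \<lessdot> lam"
  shows "young_diagram lam - young_diagram \<mu> = {skew_cell lam \<mu>}"
proof -
  obtain x where "young_diagram lam - young_diagram \<mu> = {x}"
    using assms by (auto simp: covered_by_def card_1_singleton_iff)
  then show ?thesis by (simp add: skew_cell_def)
qed

lemma crossing_cell_unique:
  assumes "\<mu> \<in> down_covers lam" and "\<nu> \<in> up_covers lam"
  shows "\<exists>!x. is_crossing_cell lam \<mu> \<nu> x"
proof -
  have mu: "\<mu> \<lessdot> lam" and nu: "lam \<lessdot> \<nu>"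
    using assms by (auto simp: down_covers_def up_covers_def)
  obtain p q where pq: "skew_cell lam \<mu> = (p, q)" by fastforce
  obtain r s where rs: "skew_cell \<nu> lam = (r, s)" by fastforce
  have part: "is_partition \<mu>" "is_partition lam" "is_partition \<nu>"
    using mu nu by (auto simp: covered_by_def)
  have a: "(p, q) \<in> young_diagram lam" "(p, q) \<notin> young_diagram \<mu>"
    using skew_cell_eq[OF mu] pq by auto
  have b: "(r, s) \<in> young_diagram \<nu>" "(r, s) \<notin> young_diagram lam"
    using skew_cell_eq[OF nu] rs by auto
  have b': "x \<in> young_diagram lam" if "x \<in> young_diagram \<nu>" "x \<noteq> (r, s)" for x
    using skew_cell_eq[OF nu] rs that by auto
  have pos: "1 \<le> p" "1 \<le> q" "1 \<le> r" "1 \<le> s"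
    using a b by (auto simp: young_diagram_def)
  have sub: "(p, q) \<in> young_diagram \<nu>"
    using a nu by (auto simp: covered_by_def)
  show ?thesis
  proof (cases "r \<le> p")
    case True
    have "q < s"
      using young_diagram_mono[OF part(2) a(1), of r s] True pos b by force
    then have "(r, q) \<in> young_diagram lam"
      using young_diagram_mono[OF part(2) a(1), of r q] True pos by auto
    moreover have "(p, s) \<notin> young_diagram lam"
      using young_diagram_mono[OF part(2), of p s r s] True pos b by auto
    ultimately show ?thesis
      unfolding is_crossing_cell_def pq rs by (intro ex1I[of _ "(r, q)"]) auto
  next
    case False
    have nq: "(r, q) \<notin> young_diagram lam"
    proof
      assume h: "(r, q) \<in> young_diagram lam"
      then have "(r, q) \<in> young_diagram \<mu>"
        using skew_cell_eq[OF mu] pq False by auto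
      then show False
        using young_diagram_mono[OF part(1), of r q p q] a pos False by auto
    qed
    have "s \<le> q"
    proof (rule ccontr)
      assume "\<not> s \<le> q"
      then have "(r, q) \<in> young_diagram \<nu>"
        using young_diagram_mono[OF part(3) b(1), of r q] pos by auto
      then show False using b'[of "(r, q)"] nq \<open>\<not> s \<le> q\<close> by auto
    qed
    then have "(p, s) \<in> young_diagram lam"
      using young_diagram_mono[OF part(2) a(1), of p s] pos by auto
    with nq show ?thesis
      unfolding is_crossing_cell_def pq rs by (intro ex1I[of _ "(p, s)"]) auto
  qed
qed

lemma young_diagram_Sigma:
  "young_diagram \<kappa> = (SIGMA r:{1..length \<kappa>}. {1..\<kappa> ! (r - 1)})"
  by (auto simp: young_diagram_def)

lemma finite_young_diagram: "finite (young_diagram \<kappa>)"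
  by (simp add: young_diagram_Sigma)

lemma card_young_diagram: "card (young_diagram \<kappa>) = sum_list \<kappa>"
proof -
  have "card (young_diagram \<kappa>) = (\<Sum>r = 1..length \<kappa>. \<kappa> ! (r - 1))"
    by (simp add: young_diagram_Sigma)
  also have "\<dots> = (\<Sum>i = 0..<length \<kappa>. \<kappa> ! i)"
    by (rule sum.reindex_bij_witness[of _ Suc "\<lambda>r. r - 1"]) auto
  finally show ?thesis by (simp add: sum_list_sum_nth)
qed

lemma finite_partitions_le: "finite {\<kappa>. is_partition \<kappa> \<and> sum_list \<kappa> \<le> m}"
proof (rule finite_subset)
  have "length \<kappa> \<le> sum_list \<kappa>" if "0 \<notin> set \<kappa>" for \<kappa> :: "nat list"
    using that by (induction \<kappa>) auto
  then show "{\<kappa>. is_partition \<kappa> \<and> sum_list \<kappa> \<le> m} \<subseteq> {\<kappa>. set \<kappa> \<subseteq> {..m} \<and> length \<kappa> \<le> m}"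
    by (force simp: is_partition_def dest: member_le_sum_list)
  show "finite {\<kappa>. set \<kappa> \<subseteq> {..m} \<and> length \<kappa> \<le> m}"
    by (rule finite_lists_length_le) simp
qed

lemma covered_by_sum_list: "\<mu> \<lessdot> lam \<Longrightarrow> sum_list lam = sum_list \<mu> + 1"
  using card_Diff_subset[OF finite_young_diagram, of \<mu> "young_diagram lam"]
    card_mono[OF finite_young_diagram, of "young_diagram \<mu>" lam]
  by (auto simp: covered_by_def card_young_diagram)

lemma finite_down_covers: "finite (down_covers lam)"
proof (rule finite_subset[OF _ finite_partitions_le[of "sum_list lam"]])
  show "down_covers lam \<subseteq> {\<kappa>. is_partition \<kappa> \<and> sum_list \<kappa> \<le> sum_list lam}"
    using covered_by_sum_list by (force simp: down_covers_def covered_by_def)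
qed

lemma finite_up_covers: "finite (up_covers lam)"
proof (rule finite_subset[OF _ finite_partitions_le[of "sum_list lam + 1"]])
  show "up_covers lam \<subseteq> {\<kappa>. is_partition \<kappa> \<and> sum_list \<kappa> \<le> sum_list lam + 1}"
    using covered_by_sum_list by (force simp: up_covers_def covered_by_def)
qed

lemma num_SYT_Nil: "num_SYT [] = 1"
proof -
  have "young_diagram [] = {}"
    by (auto simp: young_diagram_def)
  then have "standard_tableaux [] = {\<lambda>_. undefined}"
    by (auto simp: standard_tableaux_def bij_betw_def)
  then show ?thesis by (simp add: num_SYT_def)
qed

end

theory Submission
  imports Defs
begin

text \<open>Let \<open>k = length lam + 1\<close>, so that \<open>lam\<close> has \<open>k\<close> rows including an empty one, and let
  \<open>l i\<close> be the length of row \<open>i\<close> plus \<open>k - 1 - i\<close> for \<open>i < k\<close>; these numbers are distinct and the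
  last one is 0. If \<open>\<mu>\<close> shortens row \<open>j\<close> and \<open>\<nu>\<close> lengthens row \<open>i\<close>, the ratios of the numbers of
  tableaux are

  \<open>f \<mu> / f lam = u j / n\<close> with \<open>u j = l j * (\<Prod>i\<noteq>j. (l j - 1 - l i) / (l j - l i))\<close> and

  \<open>f \<nu> / f lam = (n + 1) * w i\<close> with \<open>w i = (\<Prod>j\<noteq>i. (l i + 1 - l j) / (l i - l j)) / (l i + 1)\<close>,

  and the hook length of \<open>c\<^bsub>\<mu>,\<nu>\<^esub>\<close> is \<open>\<bar>l i + 1 - l j\<bar>\<close>, the distance between the contents of the
  removed and the added cell (\<open>hook_length_crossing_cell\<close>). The two claims become

  \<open>u j * (\<Sum>i<k. w i / (l i + 1 - l j)\<^sup>2) = 1\<close> and \<open>w i * (1 + (\<Sum>j<k. u j / (l i + 1 - l j)\<^sup>2)) = 1\<close>,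

  because the weights of rows that cannot be shortened or lengthened vanish. Up to simple
  factors, \<open>w\<close> and \<open>u\<close> are the residues of \<open>\<Prod>i<k. (z - l i) / (z - l i - 1)\<close> and of its
  reciprocal. Both identities say what the derivative of such a function is at one of its
  zeros, once read off the product and once read off the partial fraction expansion
  (\<open>sum_addition_weight_over_square\<close>, \<open>sum_removal_weight_over_square\<close>).

  The ratios come from Frobenius' product formula
  \<open>f lam = n! * (\<Prod>a<b. l a - l b) / (\<Prod>i. (l i)!)\<close>. Removing the largest entry shows
  \<open>f lam = (\<Sum>\<mu>. f \<mu>)\<close> (\<open>num_SYT_branching\<close>), and the product satisfies the same recursion because
  the weights \<open>u j\<close> sum to \<open>n\<close>, which is a further coefficient comparison in the partial fraction
  expansion (\<open>sum_removal_weight\<close>). So the two are proportional by induction on \<open>n\<close>, and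
  ratios need no more.\<close>

section \<open>Partial fractions of a quotient of monic products\<close>

text \<open>The residue of \<open>\<Prod>j\<in>I. (z - a j) / (z - b j)\<close> at its simple pole \<open>b i\<close>.\<close>

definition pf_residue :: "('i \<Rightarrow> 'a::field) \<Rightarrow> ('i \<Rightarrow> 'a) \<Rightarrow> 'i set \<Rightarrow> 'i \<Rightarrow> 'a" where
  "pf_residue a b I i = (b i - a i) * (\<Prod>j\<in>I - {i}. (b i - a j) / (b i - b j))"

lemma pf_residue_insert_old:
  assumes "finite I" "m \<notin> I" "i \<in> I"
  shows "pf_residue a b (insert m I) i = pf_residue a b I i * ((b i - a m) / (b i - b m))"
proof -
  have "insert m I - {i} = insert m (I - {i})" using assms by auto
  then show ?thesis using assms by (simp add: pf_residue_def mult_ac)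
qed

lemma pf_residue_insert_new:
  assumes "m \<notin> I"
  shows "pf_residue a b (insert m I) m = (b m - a m) * (\<Prod>j\<in>I. (b m - a j) / (b m - b j))"
  using assms by (simp add: pf_residue_def)

text \<open>Induction on \<open>I\<close>: the new factor equals \<open>1 + (b m - a m) / (z - b m)\<close>, and a product of two
  simple poles splits into a difference of simple poles. The residue collected at \<open>b m\<close> is
  the right one because the induction hypothesis also holds at the point \<open>z = b m\<close>.\<close>

lemma partial_fractions:
  fixes a b :: "'i \<Rightarrow> 'a::field"
  assumes "finite I" "inj_on b I" "z \<notin> b ` I"
  shows "(\<Prod>i\<in>I. (z - a i) / (z - b i)) = 1 + (\<Sum>i\<in>I. pf_residue a b I i / (z - b i))"
  using assms
proof (induction I arbitrary: z rule: finite_induct)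
  case (insert m I)
  let ?R = "pf_residue a b I"
  have ne: "b i \<noteq> b m" "z \<noteq> b i" if "i \<in> I" for i
    using insert.prems insert.hyps that by (auto simp: inj_on_def)
  have zm: "z \<noteq> b m" using insert.prems by auto
  have new: "pf_residue a b (insert m I) m = (b m - a m) * (1 + (\<Sum>i\<in>I. ?R i / (b m - b i)))"
    using insert ne by (subst pf_residue_insert_new) (auto simp: inj_on_def image_iff)
  have trm: "?R i / (z - b i) * ((z - a m) / (z - b m))
      = ?R i * ((b i - a m) / (b i - b m)) / (z - b i)
        + (b m - a m) / (z - b m) * (?R i / (b m - b i))" if "i \<in> I" for i
  proof -
    have "b m - b i \<noteq> 0" "b i - b m \<noteq> 0" "z - b i \<noteq> 0" "z - b m \<noteq> 0"
      using ne[OF that] zm by auto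
    then show ?thesis by (simp add: divide_simps) (simp add: algebra_simps)
  qed
  have "(\<Prod>i\<in>insert m I. (z - a i) / (z - b i))
      = (1 + (\<Sum>i\<in>I. ?R i / (z - b i))) * ((z - a m) / (z - b m))"
    using insert by (simp add: mult.commute)
  also have "\<dots> = (z - a m) / (z - b m) + (\<Sum>i\<in>I. ?R i / (z - b i) * ((z - a m) / (z - b m)))"
    by (simp only: distrib_right sum_distrib_right mult_1_left)
  also have "\<dots> = (z - a m) / (z - b m)
      + ((\<Sum>i\<in>I. ?R i * ((b i - a m) / (b i - b m)) / (z - b i))
         + (b m - a m) / (z - b m) * (\<Sum>i\<in>I. ?R i / (b m - b i)))"
    by (simp only: trm sum.distrib sum_distrib_left cong: sum.cong)
  also have "\<dots> = 1 + ((\<Sum>i\<in>I. ?R i * ((b i - a m) / (b i - b m)) / (z - b i))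
         + pf_residue a b (insert m I) m / (z - b m))"
  proof -
    have "(z - a m) / (z - b m) = 1 + (b m - a m) / (z - b m)"
      using zm by (simp add: divide_simps)
    then show ?thesis unfolding new by (simp add: distrib_left add_divide_distrib)
  qed
  also have "(\<Sum>i\<in>I. ?R i * ((b i - a m) / (b i - b m)) / (z - b i))
      = (\<Sum>i\<in>I. pf_residue a b (insert m I) i / (z - b i))"
    using insert.hyps by (intro sum.cong) (simp_all add: pf_residue_insert_old)
  finally show ?case using insert.hyps by (simp add: add_ac)
qed simp

text \<open>These are the coefficients of \<open>1/z\<close> and \<open>1/z\<^sup>2\<close> in the expansion of the product at infinity.
  The induction avoids expansions: when the factor \<open>m\<close> is added, the denominators \<open>b i - b m\<close>
  from the old residues cancel against those of the new one. The first sum is needed to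
  compute the second.\<close>

lemma pf_residue_sums:
  fixes a b :: "'i \<Rightarrow> 'a::field"
  assumes "finite I" "inj_on b I"
  shows "(\<Sum>i\<in>I. pf_residue a b I i) = (\<Sum>i\<in>I. b i - a i)"
    and "2 * (\<Sum>i\<in>I. pf_residue a b I i * b i)
           = (\<Sum>i\<in>I. (b i)\<^sup>2 - (a i)\<^sup>2) + (\<Sum>i\<in>I. b i - a i)\<^sup>2"
proof -
  have "(\<Sum>i\<in>I. pf_residue a b I i) = (\<Sum>i\<in>I. b i - a i) \<and>
     2 * (\<Sum>i\<in>I. pf_residue a b I i * b i)
           = (\<Sum>i\<in>I. (b i)\<^sup>2 - (a i)\<^sup>2) + (\<Sum>i\<in>I. b i - a i)\<^sup>2"
    using assms
  proof (induction I rule: finite_induct)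
    case (insert m I)
    let ?R = "pf_residue a b I"
    have ne: "b i \<noteq> b m" if "i \<in> I" for i
      using insert.prems insert.hyps that by (auto simp: inj_on_def)
    have IH: "(\<Sum>i\<in>I. ?R i) = (\<Sum>i\<in>I. b i - a i)"
      "2 * (\<Sum>i\<in>I. ?R i * b i) = (\<Sum>i\<in>I. (b i)\<^sup>2 - (a i)\<^sup>2) + (\<Sum>i\<in>I. b i - a i)\<^sup>2"
      using insert by auto
    have new: "pf_residue a b (insert m I) m = (b m - a m) * (1 + (\<Sum>i\<in>I. ?R i / (b m - b i)))"
      using insert ne partial_fractions[of I b "b m" a]
      by (subst pf_residue_insert_new) (auto simp: inj_on_def image_iff)
    have split: "(\<Sum>i\<in>insert m I. pf_residue a b (insert m I) i * g i)
        = (b m - a m) * g m + (\<Sum>i\<in>I. ?R i * ((b i - a m) / (b i - b m)) * g i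
            + (b m - a m) * (?R i / (b m - b i)) * g m)" for g
    proof -
      have "(\<Sum>i\<in>I. pf_residue a b (insert m I) i * g i)
          = (\<Sum>i\<in>I. ?R i * ((b i - a m) / (b i - b m)) * g i)"
        using insert.hyps by (intro sum.cong) (simp_all add: pf_residue_insert_old)
      then show ?thesis
        using insert.hyps
        by (simp add: new sum.distrib algebra_simps sum_distrib_left sum_distrib_right)
    qed
    have t0: "?R i * ((b i - a m) / (b i - b m)) + (b m - a m) * (?R i / (b m - b i)) = ?R i"
      if "i \<in> I" for i
    proof -
      have "b m - b i \<noteq> 0" "b i - b m \<noteq> 0" using ne[OF that] by auto
      then show ?thesis by (simp add: divide_simps) (simp add: algebra_simps)
    qed
    have t1: "?R i * ((b i - a m) / (b i - b m)) * b i + (b m - a m) * (?R i / (b m - b i)) * b m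
        = ?R i * b i + (b m - a m) * ?R i"
      if "i \<in> I" for i
    proof -
      have "b m - b i \<noteq> 0" "b i - b m \<noteq> 0" using ne[OF that] by auto
      then show ?thesis by (simp add: divide_simps) (simp add: algebra_simps)
    qed
    have s0: "(\<Sum>i\<in>insert m I. pf_residue a b (insert m I) i) = (b m - a m) + (\<Sum>i\<in>I. ?R i)"
      using split[of "\<lambda>_. 1"] unfolding mult_1_right by (simp only: t0 cong: sum.cong)
    have s1: "(\<Sum>i\<in>insert m I. pf_residue a b (insert m I) i * b i)
        = (b m - a m) * b m + (\<Sum>i\<in>I. ?R i * b i) + (b m - a m) * (\<Sum>i\<in>I. ?R i)"
      using split[of b] by (simp only: t1 sum.distrib sum_distrib_left add.assoc cong: sum.cong)
    have "2 * (\<Sum>i\<in>insert m I. pf_residue a b (insert m I) i * b i)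
        = 2 * (b m - a m) * b m + ((\<Sum>i\<in>I. (b i)\<^sup>2 - (a i)\<^sup>2) + (\<Sum>i\<in>I. b i - a i)\<^sup>2)
          + 2 * (b m - a m) * (\<Sum>i\<in>I. b i - a i)"
      unfolding s1 IH(1) IH(2)[symmetric] by (simp add: algebra_simps)
    also have "\<dots> = (\<Sum>i\<in>insert m I. (b i)\<^sup>2 - (a i)\<^sup>2) + (\<Sum>i\<in>insert m I. b i - a i)\<^sup>2"
      using insert.hyps by (simp add: power2_eq_square algebra_simps)
    finally show ?case using s0 IH(1) insert.hyps by simp
  qed simp
  then show "(\<Sum>i\<in>I. pf_residue a b I i) = (\<Sum>i\<in>I. b i - a i)"
    and "2 * (\<Sum>i\<in>I. pf_residue a b I i * b i)
           = (\<Sum>i\<in>I. (b i)\<^sup>2 - (a i)\<^sup>2) + (\<Sum>i\<in>I. b i - a i)\<^sup>2" by auto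
qed

text \<open>Squares of differences appear when a zero \<open>a j\<close> is moved to another place \<open>c\<close>: this multiplies
  each residue by \<open>(b i - c) / (b i - a j)\<close>, and evaluating the new expansion at the old zero
  contributes a second factor \<open>b i - a j\<close>. It replaces differentiation of the expansion
  at a zero.\<close>

lemma partial_fractions_at_zero:
  fixes a b :: "'i \<Rightarrow> 'a::field"
  assumes "finite I" "inj_on b I" "j \<in> I" "a j \<notin> b ` I"
  shows "1 - (\<Sum>i\<in>I. pf_residue a b I i * (b i - c) / (b i - a j)\<^sup>2)
    = (a j - c) * (\<Prod>i\<in>I - {j}. a j - a i) / (\<Prod>i\<in>I. a j - b i)"
proof -
  have ne: "b i \<noteq> a j" "b i - a j \<noteq> 0" "a j - b i \<noteq> 0" if "i \<in> I" for i
  proof -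
    have "b i \<in> b ` I" using that by simp
    then show "b i \<noteq> a j" using assms(4) by metis
    then show "b i - a j \<noteq> 0" "a j - b i \<noteq> 0" by auto
  qed
  have res: "pf_residue (a(j := c)) b I i = pf_residue a b I i * ((b i - c) / (b i - a j))"
    if "i \<in> I" for i
  proof (cases "i = j")
    case True
    then have "(\<Prod>h\<in>I - {j}. (b i - (a(j := c)) h) / (b i - b h))
        = (\<Prod>h\<in>I - {j}. (b i - a h) / (b i - b h))"
      by (intro prod.cong) auto
    then show ?thesis using True ne[OF that] by (simp add: pf_residue_def)
  next
    case False
    have "(\<Prod>h\<in>I - {i} - {j}. (b i - (a(j := c)) h) / (b i - b h))
        = (\<Prod>h\<in>I - {i} - {j}. (b i - a h) / (b i - b h))"
      by (intro prod.cong) auto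
    then show ?thesis
      using False assms ne[OF that]
      by (simp add: pf_residue_def prod.remove[of "I - {i}" j])
  qed
  have "1 - (\<Sum>i\<in>I. pf_residue a b I i * (b i - c) / (b i - a j)\<^sup>2)
      = 1 + (\<Sum>i\<in>I. pf_residue (a(j := c)) b I i / (a j - b i))"
  proof -
    have "- (pf_residue a b I i * (b i - c) / (b i - a j)\<^sup>2)
        = pf_residue (a(j := c)) b I i / (a j - b i)" if "i \<in> I" for i
      using ne[OF that] unfolding res[OF that]
      by (simp add: divide_simps power2_eq_square) (simp add: algebra_simps)
    then show ?thesis by (simp add: sum_negf[symmetric])
  qed
  also have "\<dots> = (\<Prod>i\<in>I. (a j - (a(j := c)) i) / (a j - b i))"
    using assms by (intro partial_fractions[symmetric])
  also have "\<dots> = (\<Prod>i\<in>I. a j - (a(j := c)) i) / (\<Prod>i\<in>I. a j - b i)"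
    by (rule prod_dividef)
  also have "(\<Prod>i\<in>I. a j - (a(j := c)) i) = (a j - c) * (\<Prod>i\<in>I - {j}. a j - a i)"
  proof -
    have "(\<Prod>i\<in>I - {j}. a j - (a(j := c)) i) = (\<Prod>i\<in>I - {j}. a j - a i)"
      by (intro prod.cong) auto
    then show ?thesis using assms by (simp add: prod.remove[of I j])
  qed
  finally show ?thesis .
qed

section \<open>The weights of removing and adding a cell, and their sums\<close>

text \<open>For the shifted row lengths \<open>l\<close> (below) of a partition of \<open>n\<close>, the weight of \<open>j\<close> is
  \<open>n\<close> times the ratio of the numbers of tableaux after and before shortening row \<open>j\<close>.\<close>

definition removal_weight :: "('i \<Rightarrow> real) \<Rightarrow> 'i set \<Rightarrow> 'i \<Rightarrow> real" where
  "removal_weight l I j = l j * (\<Prod>i\<in>I - {j}. (l j - 1 - l i) / (l j - l i))"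

text \<open>Likewise the ratio for lengthening row \<open>i\<close>, divided by \<open>n + 1\<close>.\<close>

definition addition_weight :: "('i \<Rightarrow> real) \<Rightarrow> 'i set \<Rightarrow> 'i \<Rightarrow> real" where
  "addition_weight l I i = (\<Prod>j\<in>I - {i}. (l i + 1 - l j) / (l i - l j)) / (l i + 1)"

lemma removal_weight_residue:
  "removal_weight l I j = - pf_residue (\<lambda>i. l i + 1) l I j * l j"
  by (simp add: removal_weight_def pf_residue_def diff_diff_eq add.commute)

lemma addition_weight_residue:
  "addition_weight l I i = pf_residue l (\<lambda>i. l i + 1) I i / (l i + 1)"
  by (simp add: addition_weight_def pf_residue_def)

lemma sum_removal_weight:
  assumes "finite I" "inj_on l I"
  shows "(\<Sum>j\<in>I. removal_weight l I j) = (\<Sum>j\<in>I. l j) - real (card I) * (real (card I) - 1) / 2"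
proof -
  have "2 * (\<Sum>j\<in>I. pf_residue (\<lambda>i. l i + 1) l I j * l j)
      = (\<Sum>j\<in>I. (l j)\<^sup>2 - (l j + 1)\<^sup>2) + (\<Sum>j\<in>I. l j - (l j + 1))\<^sup>2"
    using assms by (rule pf_residue_sums(2))
  also have "\<dots> = - 2 * (\<Sum>j\<in>I. l j) - real (card I) + (real (card I))\<^sup>2"
    by (simp add: power2_eq_square algebra_simps sum_subtractf sum.distrib sum_distrib_right[symmetric] sum_negf)
  finally show ?thesis
    by (simp add: removal_weight_residue sum_negf power2_eq_square field_simps)
qed

text \<open>Up to factors \<open>1 / x\<close> at \<open>x = l i + 1\<close>, the addition weights are the residues of
  \<open>H z = (\<Prod>i\<in>I. (z - l i) / (z - l i - 1))\<close>. Moving the zero \<open>l j\<close> to \<open>0\<close> and to \<open>1\<close> and subtracting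
  gives the sum of residues over squares. The remaining factor \<open>1 / x\<close> is removed by
  splitting \<open>1 / (x (x - l j)\<^sup>2)\<close> into partial fractions: the contributions of its simple poles
  cancel, because \<open>H\<close> vanishes both at \<open>l j\<close> and at \<open>l z = 0\<close>.\<close>

lemma sum_addition_weight_over_square:
  assumes I: "finite I" "inj_on l I" "j \<in> I" and zero: "z \<in> I" "l z = 0"
    and ne: "l j \<noteq> 0" "\<And>i. i \<in> I \<Longrightarrow> l i + 1 \<noteq> l j" "\<And>i. i \<in> I \<Longrightarrow> l i + 1 \<noteq> 0"
  shows "removal_weight l I j * (\<Sum>i\<in>I. addition_weight l I i / (l i + 1 - l j)\<^sup>2) = 1"
proof -
  let ?x = "\<lambda>i. l i + 1"
  let ?R = "pf_residue l ?x I"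
  let ?K = "(\<Prod>i\<in>I - {j}. l j - l i) / (\<Prod>i\<in>I. l j - ?x i)"
  have inj: "inj_on ?x I" using I by (auto simp: inj_on_def)
  \<comment> \<open>the expansion evaluated at a zero of the product\<close>
  have at: "(\<Sum>i\<in>I. ?R i / (?x i - l p)) = 1" if "p \<in> I" "l p \<notin> ?x ` I" for p
  proof -
    have "(\<Prod>i\<in>I. (l p - l i) / (l p - ?x i)) = 0" using I that by (auto intro!: prod_zero)
    then have "1 + (\<Sum>i\<in>I. ?R i / (l p - ?x i)) = 0"
      using partial_fractions[OF I(1) inj that(2), of l] by simp
    moreover have "(\<Sum>i\<in>I. ?R i / (?x i - l p)) = - (\<Sum>i\<in>I. ?R i / (l p - ?x i))"
      unfolding sum_negf[symmetric]
      by (intro sum.cong refl) (metis minus_diff_eq divide_minus_right)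
    ultimately show ?thesis by simp
  qed
  have nin: "l j \<notin> ?x ` I" "l z \<notin> ?x ` I" using ne zero by fastforce+
  have sq: "(\<Sum>i\<in>I. ?R i / (?x i - l j)\<^sup>2) = - ?K"
  proof -
    have "(\<Sum>i\<in>I. ?R i / (?x i - l j)\<^sup>2)
      = (\<Sum>i\<in>I. ?R i * (?x i - 0) / (?x i - l j)\<^sup>2) - (\<Sum>i\<in>I. ?R i * (?x i - 1) / (?x i - l j)\<^sup>2)"
      unfolding sum_subtractf[symmetric]
      by (intro sum.cong refl) (simp add: diff_divide_distrib[symmetric] algebra_simps)
    also have "\<dots> = (l j - 1) * ?K - (l j - 0) * ?K"
      using partial_fractions_at_zero[where a = l and c = 0, OF I(1) inj I(3) nin(1)]
        partial_fractions_at_zero[where a = l and c = 1, OF I(1) inj I(3) nin(1)] by simp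
    also have "\<dots> = - ?K"
    proof -
      have "(l j - 1) * K - (l j - 0) * K = - K" for K by (simp add: algebra_simps)
      then show ?thesis .
    qed
    finally show ?thesis .
  qed
  have trm: "addition_weight l I i / (?x i - l j)\<^sup>2
      = (?R i / (?x i - l z) - ?R i / (?x i - l j)) / (l j)\<^sup>2 + ?R i / (?x i - l j)\<^sup>2 / l j"
    if "i \<in> I" for i
  proof -
    define y where "y = l i + 1"
    have "y \<noteq> 0" "y - l j \<noteq> 0" using ne that by (auto simp: y_def)
    then have "?R i / y / (y - l j)\<^sup>2
      = (?R i / (y - 0) - ?R i / (y - l j)) / (l j)\<^sup>2 + ?R i / (y - l j)\<^sup>2 / l j"
      using ne(1) by (simp add: divide_simps power2_eq_square) algebra
    then show ?thesis by (simp add: addition_weight_residue y_def zero)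
  qed
  have "(\<Sum>i\<in>I. addition_weight l I i / (?x i - l j)\<^sup>2)
      = ((\<Sum>i\<in>I. ?R i / (?x i - l z)) - (\<Sum>i\<in>I. ?R i / (?x i - l j))) / (l j)\<^sup>2
        + (\<Sum>i\<in>I. ?R i / (?x i - l j)\<^sup>2) / l j"
    by (simp only: trm sum.distrib sum_subtractf sum_divide_distrib[symmetric] cong: sum.cong)
  also have "\<dots> = - ?K / l j"
    using at[OF zero(1) nin(2)] at[OF I(3) nin(1)] sq by simp
  finally have S: "(\<Sum>i\<in>I. addition_weight l I i / (?x i - l j)\<^sup>2) = - ?K / l j" .
  have "(\<Prod>i\<in>I. l j - ?x i) = - (\<Prod>i\<in>I - {j}. l j - 1 - l i)"
    using I by (simp add: prod.remove[of I j] diff_diff_eq add.commute)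
  then have U: "removal_weight l I j = - l j / ?K"
    by (simp add: removal_weight_def prod_dividef)
  have "?K \<noteq> 0"
    using I ne by (fastforce simp: prod_zero_iff inj_on_def)
  then show ?thesis unfolding S U using ne(1) by (simp only: field_simps) simp
qed

text \<open>The removal weights are, up to the sign and a factor \<open>l j\<close>, the residues of the reciprocal
  \<open>\<Prod>j\<in>I. (z - l j - 1) / (z - l j)\<close>. Moving its zero \<open>l i + 1\<close> to \<open>0\<close> produces precisely that factor.\<close>

lemma sum_removal_weight_over_square:
  assumes I: "finite I" "inj_on l I" "i \<in> I"
    and ne: "l i + 1 \<noteq> 0" "\<And>j. j \<in> I \<Longrightarrow> l i + 1 \<noteq> l j"
  shows "addition_weight l I i * (1 + (\<Sum>j\<in>I. removal_weight l I j / (l i + 1 - l j)\<^sup>2)) = 1"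
proof -
  let ?x = "\<lambda>i. l i + 1"
  let ?M = "(\<Prod>j\<in>I - {i}. l i - l j) / (\<Prod>j\<in>I. ?x i - l j)"
  have nin: "?x i \<notin> l ` I" using ne by auto
  have "1 + (\<Sum>j\<in>I. removal_weight l I j / (?x i - l j)\<^sup>2)
      = 1 - (\<Sum>j\<in>I. pf_residue ?x l I j * (l j - 0) / (l j - ?x i)\<^sup>2)"
    by (simp add: removal_weight_residue sum_negf power2_commute)
  also have "\<dots> = (?x i - 0) * (\<Prod>j\<in>I - {i}. ?x i - ?x j) / (\<Prod>j\<in>I. ?x i - l j)"
    using I nin by (intro partial_fractions_at_zero)
  also have "\<dots> = ?x i * ?M" by simp
  finally have S: "1 + (\<Sum>j\<in>I. removal_weight l I j / (?x i - l j)\<^sup>2) = ?x i * ?M" .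
  have "(\<Prod>j\<in>I. ?x i - l j) = (\<Prod>j\<in>I - {i}. ?x i - l j)"
    using I by (simp add: prod.remove[of I i])
  then have W: "addition_weight l I i = 1 / ?M / ?x i"
    by (simp add: addition_weight_def prod_dividef)
  have "?M \<noteq> 0" using I ne by (fastforce simp: prod_zero_iff inj_on_def)
  then show ?thesis unfolding S W using ne(1) by (simp only: field_simps) simp
qed

section \<open>Partitions as row lengths, and covers as rows\<close>

text \<open>Rows are numbered from 0 here, and all rows beyond the last part have length 0. With this
  padding a cover is a change of the function at one place, also when a part appears or
  disappears.\<close>

definition row :: "nat list \<Rightarrow> nat \<Rightarrow> nat" where
  "row \<kappa> i = (if i < length \<kappa> then \<kappa> ! i else 0)"

lemma mem_young_diagram_iff:
  "(r, c) \<in> young_diagram \<kappa> \<longleftrightarrow> 1 \<le> r \<and> 1 \<le> c \<and> c \<le> row \<kappa> (r - 1)"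
  by (auto simp: young_diagram_def row_def)

lemma row_antimono: "is_partition \<kappa> \<Longrightarrow> i \<le> j \<Longrightarrow> row \<kappa> j \<le> row \<kappa> i"
  using sorted_wrt_nth_less[of "(\<ge>)" \<kappa> i j]
  by (cases "i = j") (auto simp: row_def is_partition_def)

lemma row_eq_0_iff: "is_partition \<kappa> \<Longrightarrow> row \<kappa> i = 0 \<longleftrightarrow> length \<kappa> \<le> i"
  by (auto simp: row_def is_partition_def in_set_conv_nth)

lemma sum_row: "length \<kappa> \<le> k \<Longrightarrow> (\<Sum>i<k. row \<kappa> i) = sum_list \<kappa>"
proof -
  assume "length \<kappa> \<le> k"
  then have "(\<Sum>i<k. row \<kappa> i) = (\<Sum>i<length \<kappa>. \<kappa> ! i)"
    by (intro sum.mono_neutral_cong_right) (auto simp: row_def)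
  then show ?thesis by (simp add: sum_list_sum_nth atLeast0LessThan)
qed

lemma partition_eqI:
  assumes "is_partition \<kappa>" "is_partition \<kappa>'" "row \<kappa> = row \<kappa>'"
  shows "\<kappa> = \<kappa>'"
proof (rule nth_equalityI)
  show len: "length \<kappa> = length \<kappa>'"
    using row_eq_0_iff[OF assms(1), of "length \<kappa>"] row_eq_0_iff[OF assms(2), of "length \<kappa>"]
      row_eq_0_iff[OF assms(1), of "length \<kappa>'"] row_eq_0_iff[OF assms(2), of "length \<kappa>'"]
    by (simp add: assms(3))
  show "\<kappa> ! i = \<kappa>' ! i" if "i < length \<kappa>" for i
    using fun_cong[OF assms(3), of i] that len by (simp add: row_def)
qed

lemma partition_with_rows:
  assumes "\<And>i. q (Suc i) \<le> q i" "q m = 0"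
  obtains \<kappa> where "is_partition \<kappa>" "row \<kappa> = q"
proof
  define L where "L = (LEAST i. q i = 0)"
  have q0: "q L = 0" unfolding L_def using assms(2) by (rule LeastI)
  have pos: "q i \<noteq> 0" if "i < L" for i using not_less_Least[of i "\<lambda>i. q i = 0"] that by (simp add: L_def)
  have anti: "q j \<le> q i" if "i \<le> j" for i j using lift_Suc_antimono_le[of q, OF assms(1) that] .
  show "is_partition (map q [0..<L])"
    using anti by (auto simp: is_partition_def sorted_wrt_iff_nth_less pos)
  show "row (map q [0..<L]) = q"
  proof
    fix i show "row (map q [0..<L]) i = q i"
      using q0 anti[of L i] by (simp add: row_def)
  qed
qed

lemma row_Suc_eq_iff:
  "row lam = (row \<mu>)(i := Suc (row \<mu> i))
    \<longleftrightarrow> young_diagram lam = insert (Suc i, Suc (row \<mu> i)) (young_diagram \<mu>)"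
proof
  assume h: "row lam = (row \<mu>)(i := Suc (row \<mu> i))"
  show "young_diagram lam = insert (Suc i, Suc (row \<mu> i)) (young_diagram \<mu>)"
  proof (rule set_eqI)
    fix x :: cell
    obtain r c where x: "x = (r, c)" by fastforce
    show "x \<in> young_diagram lam \<longleftrightarrow> x \<in> insert (Suc i, Suc (row \<mu> i)) (young_diagram \<mu>)"
      unfolding x using h by (cases r) (auto simp: mem_young_diagram_iff)
  qed
next
  assume h: "young_diagram lam = insert (Suc i, Suc (row \<mu> i)) (young_diagram \<mu>)"
  have mem: "Suc c \<le> row lam j \<longleftrightarrow> Suc c \<le> row \<mu> j \<or> (j = i \<and> c = row \<mu> i)" for c j
  proof -
    have "(Suc j, Suc c) \<in> young_diagram lam
        \<longleftrightarrow> (Suc j, Suc c) \<in> insert (Suc i, Suc (row \<mu> i)) (young_diagram \<mu>)"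
      using h by simp
    then show ?thesis by (auto simp: mem_young_diagram_iff)
  qed
  have eqI: "a = b" if "\<And>c. Suc c \<le> a \<longleftrightarrow> Suc c \<le> b" for a b :: nat
    using that[of a] that[of b] by linarith
  show "row lam = (row \<mu>)(i := Suc (row \<mu> i))"
  proof
    fix j
    show "row lam j = ((row \<mu>)(i := Suc (row \<mu> i))) j"
      by (rule eqI) (auto simp: mem)
  qed
qed

lemma covered_byE:
  assumes "\<mu> \<lessdot> lam"
  obtains i where "row lam = (row \<mu>)(i := Suc (row \<mu> i))" "skew_cell lam \<mu> = (Suc i, row lam i)"
proof -
  obtain p q where pq: "skew_cell lam \<mu> = (p, q)" by fastforce
  have part: "is_partition \<mu>" "is_partition lam" and sub: "young_diagram \<mu> \<subseteq> young_diagram lam"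
    using assms by (auto simp: covered_by_def)
  have D: "young_diagram lam = insert (p, q) (young_diagram \<mu>)" and new: "(p, q) \<notin> young_diagram \<mu>"
    using skew_cell_eq[OF assms] sub pq by auto
  have "(p, q) \<in> young_diagram lam" using D by simp
  then obtain i where p: "p = Suc i" and q: "1 \<le> q" "q \<le> row lam i"
    by (cases p) (auto simp: mem_young_diagram_iff)
  have q1: "row \<mu> i < q" using new p q by (auto simp: mem_young_diagram_iff)
  then have "(Suc i, Suc (row \<mu> i)) \<in> young_diagram lam"
    using q by (simp add: mem_young_diagram_iff)
  then have "q = Suc (row \<mu> i)" unfolding D p by (auto simp: mem_young_diagram_iff)
  then have r: "row lam = (row \<mu>)(i := Suc (row \<mu> i))"
    using D p by (simp add: row_Suc_eq_iff)
  show ?thesis using that[OF r] pq p r \<open>q = _\<close> by simp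
qed

lemma covered_byI:
  assumes "is_partition \<mu>" "is_partition lam" "row lam = (row \<mu>)(i := Suc (row \<mu> i))"
  shows "\<mu> \<lessdot> lam"
proof -
  have "young_diagram lam = insert (Suc i, Suc (row \<mu> i)) (young_diagram \<mu>)"
    using assms(3) by (simp add: row_Suc_eq_iff)
  moreover have "(Suc i, Suc (row \<mu> i)) \<notin> young_diagram \<mu>" by (simp add: mem_young_diagram_iff)
  ultimately have "young_diagram lam - young_diagram \<mu> = {(Suc i, Suc (row \<mu> i))}"
    "young_diagram \<mu> \<subseteq> young_diagram lam" by auto
  then show ?thesis using assms by (simp add: covered_by_def)
qed

definition cover_row :: "nat list \<Rightarrow> nat list \<Rightarrow> nat" where
  "cover_row lam \<mu> = fst (skew_cell lam \<mu>) - 1"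

lemma cover_row:
  assumes "\<mu> \<lessdot> lam"
  shows "row lam = (row \<mu>)(cover_row lam \<mu> := Suc (row \<mu> (cover_row lam \<mu>)))"
    and "skew_cell lam \<mu> = (Suc (cover_row lam \<mu>), row lam (cover_row lam \<mu>))"
  using assms by (auto elim!: covered_byE simp: cover_row_def)

lemma cover_row_less_length:
  assumes "\<mu> \<lessdot> lam"
  shows "cover_row lam \<mu> < length lam"
proof -
  have "row lam (cover_row lam \<mu>) \<noteq> 0" using fun_cong[OF cover_row(1)[OF assms]] by simp
  then show ?thesis by (auto simp: row_def split: if_splits)
qed

definition removable_rows :: "nat list \<Rightarrow> nat set" where
  "removable_rows lam = {i. row lam (Suc i) < row lam i}"

definition addable_rows :: "nat list \<Rightarrow> nat set" where
  "addable_rows lam = {i. i = 0 \<or> row lam i < row lam (i - 1)}"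

lemma bij_betw_down_covers:
  assumes "is_partition lam"
  shows "bij_betw (cover_row lam) (down_covers lam) (removable_rows lam)"
proof (rule bij_betw_imageI)
  show "inj_on (cover_row lam) (down_covers lam)"
  proof (rule inj_onI)
    fix \<mu> \<mu>' assume h: "\<mu> \<in> down_covers lam" "\<mu>' \<in> down_covers lam"
      "cover_row lam \<mu> = cover_row lam \<mu>'"
    then have c: "\<mu> \<lessdot> lam" "\<mu>' \<lessdot> lam" by (auto simp: down_covers_def)
    have "row \<mu> i = row \<mu>' i" for i
      using fun_cong[OF cover_row(1)[OF c(1)], of i] fun_cong[OF cover_row(1)[OF c(2)], of i] h(3)
      by (simp split: if_splits)
    then show "\<mu> = \<mu>'" using c by (intro partition_eqI) (auto simp: covered_by_def)
  qed
  show "cover_row lam ` down_covers lam = removable_rows lam"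
  proof (intro equalityI subsetI)
    fix i assume "i \<in> cover_row lam ` down_covers lam"
    then obtain \<mu> where c: "\<mu> \<lessdot> lam" and i: "i = cover_row lam \<mu>" by (auto simp: down_covers_def)
    have r: "row lam = (row \<mu>)(i := Suc (row \<mu> i))" unfolding i by (rule cover_row(1)[OF c])
    have "row \<mu> (Suc i) \<le> row \<mu> i" using c by (intro row_antimono) (auto simp: covered_by_def)
    then show "i \<in> removable_rows lam" unfolding r removable_rows_def by simp
  next
    fix i assume i: "i \<in> removable_rows lam"
    let ?q = "(row lam)(i := row lam i - 1)"
    have "?q (Suc j) \<le> ?q j" for j
      using i row_antimono[OF assms, of j "Suc j"] by (auto simp: removable_rows_def)
    moreover have "?q (length lam) = 0" by (simp add: row_def)
    ultimately obtain \<mu> where mu: "is_partition \<mu>" "row \<mu> = ?q" by (rule partition_with_rows)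
    have r: "row lam = (row \<mu>)(i := Suc (row \<mu> i))"
      using i by (auto simp: mu(2) removable_rows_def fun_eq_iff)
    then have c: "\<mu> \<lessdot> lam" using mu assms by (intro covered_byI)
    have "cover_row lam \<mu> = i"
      using fun_cong[OF cover_row(1)[OF c], of i] fun_cong[OF r, of i] by (simp split: if_splits)
    then show "i \<in> cover_row lam ` down_covers lam" using c by (force simp: down_covers_def)
  qed
qed

lemma bij_betw_up_covers:
  assumes "is_partition lam"
  shows "bij_betw (\<lambda>\<nu>. cover_row \<nu> lam) (up_covers lam) (addable_rows lam)"
proof (rule bij_betw_imageI)
  show "inj_on (\<lambda>\<nu>. cover_row \<nu> lam) (up_covers lam)"
  proof (rule inj_onI)
    fix \<nu> \<nu>' assume h: "\<nu> \<in> up_covers lam" "\<nu>' \<in> up_covers lam"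
      "cover_row \<nu> lam = cover_row \<nu>' lam"
    then have c: "lam \<lessdot> \<nu>" "lam \<lessdot> \<nu>'" by (auto simp: up_covers_def)
    have "row \<nu> = row \<nu>'" using cover_row(1)[OF c(1)] cover_row(1)[OF c(2)] h(3) by simp
    then show "\<nu> = \<nu>'" using c by (intro partition_eqI) (auto simp: covered_by_def)
  qed
  show "(\<lambda>\<nu>. cover_row \<nu> lam) ` up_covers lam = addable_rows lam"
  proof (intro equalityI subsetI)
    fix i assume "i \<in> (\<lambda>\<nu>. cover_row \<nu> lam) ` up_covers lam"
    then obtain \<nu> where c: "lam \<lessdot> \<nu>" and i: "i = cover_row \<nu> lam" by (auto simp: up_covers_def)
    have r: "row \<nu> = (row lam)(i := Suc (row lam i))" unfolding i by (rule cover_row(1)[OF c])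
    have "row \<nu> i \<le> row \<nu> (i - 1)" using c by (intro row_antimono) (auto simp: covered_by_def)
    then show "i \<in> addable_rows lam" unfolding r by (auto simp: addable_rows_def split: if_splits)
  next
    fix i assume i: "i \<in> addable_rows lam"
    let ?q = "(row lam)(i := Suc (row lam i))"
    have "?q (Suc j) \<le> ?q j" for j
      using i row_antimono[OF assms, of j "Suc j"] by (auto simp: addable_rows_def)
    moreover have "?q (max (Suc i) (length lam)) = 0" by (simp add: row_def)
    ultimately obtain \<nu> where nu: "is_partition \<nu>" "row \<nu> = ?q" by (rule partition_with_rows)
    then have c: "lam \<lessdot> \<nu>" using assms by (intro covered_byI)
    have "cover_row \<nu> lam = i"
      using fun_cong[OF cover_row(1)[OF c], of i] fun_cong[OF nu(2), of i] by (simp split: if_splits)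
    then show "i \<in> (\<lambda>\<nu>. cover_row \<nu> lam) ` up_covers lam" using c by (force simp: up_covers_def)
  qed
qed

section \<open>The hook of the crossing cell\<close>

text \<open>The hook of \<open>c\<^bsub>\<mu>,\<nu>\<^esub>\<close> joins the removed to the added cell, so its length is the distance of
  their contents (column minus row). In the two cases the added cell lies to the right of the
  removed one, respectively above it.\<close>

lemma hook_length_crossing_cell:
  assumes "\<mu> \<in> down_covers lam" "\<nu> \<in> up_covers lam"
  defines "j \<equiv> cover_row lam \<mu>" and "i \<equiv> cover_row \<nu> lam"
  shows "int (hook_length lam (crossing_cell lam \<mu> \<nu>))
    = \<bar>(int (row lam i) + 1 - int i) - (int (row lam j) - int j)\<bar>"
proof -
  have mu: "\<mu> \<lessdot> lam" and nu: "lam \<lessdot> \<nu>"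
    using assms(1,2) by (simp_all add: down_covers_def up_covers_def)
  have part: "is_partition lam" using mu by (simp add: covered_by_def)
  have "j \<in> removable_rows lam" "i \<in> addable_rows lam"
    unfolding i_def j_def using assms(1,2)
      bij_betwE[OF bij_betw_down_covers[OF part]] bij_betwE[OF bij_betw_up_covers[OF part]] by blast+
  then have j: "row lam (Suc j) < row lam j" and i: "i = 0 \<or> row lam i < row lam (i - 1)"
    by (simp_all add: removable_rows_def addable_rows_def)
  have sm: "skew_cell lam \<mu> = (Suc j, row lam j)"
    unfolding j_def by (rule cover_row(2)[OF mu])
  have sn: "skew_cell \<nu> lam = (Suc i, Suc (row lam i))"
    using cover_row(2)[OF nu] fun_cong[OF cover_row(1)[OF nu], of i] by (simp add: i_def)
  have crossI: "crossing_cell lam \<mu> \<nu> = x" if "is_crossing_cell lam \<mu> \<nu> x" for x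
    unfolding crossing_cell_def using crossing_cell_unique[OF assms(1,2)] that by (rule the1_equality)
  have arm: "arm lam (r, c) = row lam (r - 1) - c" if "1 \<le> r" "1 \<le> c" for r c
  proof -
    have "{c'. c < c' \<and> (r, c') \<in> young_diagram lam} = {c<..row lam (r - 1)}"
      using that by (auto simp: mem_young_diagram_iff)
    then show ?thesis by (simp add: arm_def)
  qed
  have leg: "leg lam (r, c) = t - r" if "1 \<le> r" "1 \<le> c" "\<And>p. r \<le> p \<Longrightarrow> c \<le> row lam p \<longleftrightarrow> p < t" for r c t
  proof -
    have "{r'. r < r' \<and> (r', c) \<in> young_diagram lam} = {r<..t}"
    proof (rule set_eqI)
      fix r' show "r' \<in> {r'. r < r' \<and> (r', c) \<in> young_diagram lam} \<longleftrightarrow> r' \<in> {r<..t}"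
        using that by (cases r') (auto simp: mem_young_diagram_iff)
    qed
    then show ?thesis by (simp add: leg_def)
  qed
  show ?thesis
  proof (cases "i \<le> j")
    case True
    have ji: "row lam j \<le> row lam i" using row_antimono[OF part True] .
    have "is_crossing_cell lam \<mu> \<nu> (Suc i, row lam j)"
      using j ji by (simp add: is_crossing_cell_def sm sn mem_young_diagram_iff)
    then have x: "crossing_cell lam \<mu> \<nu> = (Suc i, row lam j)" by (rule crossI)
    have "row lam j \<le> row lam p \<longleftrightarrow> p < Suc j" for p
      using row_antimono[OF part, of p j] row_antimono[OF part, of "Suc j" p] j
      by (cases "p \<le> j") auto
    then have "leg lam (Suc i, row lam j) = Suc j - Suc i" using j by (intro leg) auto
    then show ?thesis unfolding x hook_length_def using True ji j by (simp add: arm)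
  next
    case False
    then have ij: "Suc j \<le> i - 1 \<or> i = Suc j" by auto
    then have lt: "row lam i < row lam j"
      using row_antimono[OF part, of j "i - 1"] i j by auto
    have "is_crossing_cell lam \<mu> \<nu> (Suc j, Suc (row lam i))"
      using lt by (simp add: is_crossing_cell_def sm sn mem_young_diagram_iff)
    then have x: "crossing_cell lam \<mu> \<nu> = (Suc j, Suc (row lam i))" by (rule crossI)
    have "Suc (row lam i) \<le> row lam p \<longleftrightarrow> p < i" for p
    proof (cases "p < i")
      case True
      then show ?thesis using row_antimono[OF part, of p "i - 1"] i False by fastforce
    next
      case False
      then show ?thesis using row_antimono[OF part, of i p] by simp
    qed
    then have "leg lam (Suc j, Suc (row lam i)) = i - Suc j" by (intro leg) auto
    then show ?thesis unfolding x hook_length_def using False lt by (simp add: arm)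
  qed
qed

section \<open>Branching of standard tableaux\<close>

text \<open>Treats the row and the column condition on tableaux as one.\<close>

definition precedes :: "cell \<Rightarrow> cell \<Rightarrow> bool" where
  "precedes x y \<longleftrightarrow> fst x = fst y \<and> snd x < snd y \<or> snd x = snd y \<and> fst x < fst y"

lemma standard_tableaux_iff:
  "T \<in> standard_tableaux \<kappa> \<longleftrightarrow> T \<in> extensional (young_diagram \<kappa>) \<and>
     bij_betw T (young_diagram \<kappa>) {1..sum_list \<kappa>} \<and>
     (\<forall>x\<in>young_diagram \<kappa>. \<forall>y\<in>young_diagram \<kappa>. precedes x y \<longrightarrow> T x < T y)"
  unfolding standard_tableaux_def precedes_def by fastforce

lemma precedes_mem:
  assumes "is_partition \<kappa>" "y \<in> young_diagram \<kappa>" "precedes x y" "1 \<le> fst x" "1 \<le> snd x"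
  shows "x \<in> young_diagram \<kappa>"
  using assms young_diagram_mono[of \<kappa> "fst y" "snd y" "fst x" "snd x"]
  by (auto simp: precedes_def)

lemma finite_standard_tableaux: "finite (standard_tableaux \<kappa>)"
proof (rule finite_subset)
  show "standard_tableaux \<kappa> \<subseteq> (young_diagram \<kappa> \<rightarrow>\<^sub>E {1..sum_list \<kappa>})"
    by (auto simp: standard_tableaux_iff PiE_def dest!: bij_betwE simp del: atLeastAtMost_iff)
  show "finite (young_diagram \<kappa> \<rightarrow>\<^sub>E {1..sum_list \<kappa>})"
    by (intro finite_PiE finite_young_diagram) simp
qed

text \<open>Nothing follows the new cell in its row or column, so it may carry the largest entry.\<close>

lemma extend_standard_tableau:
  assumes "\<mu> \<lessdot> lam" "S \<in> standard_tableaux \<mu>"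
  shows "S(skew_cell lam \<mu> := sum_list lam) \<in> standard_tableaux lam"
proof -
  let ?x = "skew_cell lam \<mu>" and ?n = "sum_list lam"
  let ?T = "S(?x := ?n)"
  have part: "is_partition \<mu>" using assms by (simp add: covered_by_def)
  have D: "young_diagram lam = insert ?x (young_diagram \<mu>)" and x: "?x \<notin> young_diagram \<mu>"
    using skew_cell_eq[OF assms(1)] assms(1) by (auto simp: covered_by_def)
  have n: "?n = Suc (sum_list \<mu>)" using covered_by_sum_list[OF assms(1)] by simp
  have S: "S \<in> extensional (young_diagram \<mu>)" "bij_betw S (young_diagram \<mu>) {1..sum_list \<mu>}"
    "\<And>y z. y \<in> young_diagram \<mu> \<Longrightarrow> z \<in> young_diagram \<mu> \<Longrightarrow> precedes y z \<Longrightarrow> S y < S z"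
    using assms(2) by (auto simp: standard_tableaux_iff)
  have "bij_betw ?T (young_diagram \<mu>) {1..sum_list \<mu>}"
    using S(2) x by (subst bij_betw_cong[of _ _ S]) auto
  then have "bij_betw ?T (young_diagram \<mu> \<union> {?x}) ({1..sum_list \<mu>} \<union> {?T ?x})"
    using x n by (intro notIn_Un_bij_betw) auto
  moreover have "{1..sum_list \<mu>} \<union> {?T ?x} = {1..?n}" using n by auto
  ultimately have bij: "bij_betw ?T (young_diagram lam) {1..?n}" unfolding D by simp
  have less: "S y < ?n" if "y \<in> young_diagram \<mu>" for y
    using bij_betwE[OF S(2)] that n by fastforce
  have "?T y < ?T z" if h: "y \<in> young_diagram lam" "z \<in> young_diagram lam" "precedes y z" for y z
  proof -
    have "y \<noteq> z" using h(3) by (auto simp: precedes_def)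
    have "y \<in> young_diagram \<mu>"
    proof (cases "z = ?x")
      case False
      then have "z \<in> young_diagram \<mu>" using h D by auto
      moreover have "1 \<le> fst y" "1 \<le> snd y" using h(1) by (auto simp: young_diagram_def)
      ultimately show ?thesis using precedes_mem[OF part _ h(3)] by simp
    next
      case True
      then show ?thesis using h(1) D \<open>y \<noteq> z\<close> by simp
    qed
    then have "y \<noteq> ?x" "S y < ?n" and "z \<in> young_diagram \<mu> \<Longrightarrow> S y < S z"
      using x less S(3) h(3) by auto
    moreover have "z = ?x \<or> z \<in> young_diagram \<mu>" using h(2) D by simp
    ultimately show ?thesis by auto
  qed
  moreover have "?T \<in> extensional (young_diagram lam)" using S(1) D by (auto simp: extensional_def)
  ultimately show ?thesis using bij by (simp add: standard_tableaux_iff)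
qed

text \<open>The cell with the largest entry has no cell to its right or above it, hence ends a row that
  can be shortened.\<close>

lemma restrict_standard_tableau:
  assumes "is_partition lam" "1 \<le> sum_list lam" "T \<in> standard_tableaux lam"
  obtains \<mu> S where "\<mu> \<lessdot> lam" "S \<in> standard_tableaux \<mu>" "T = S(skew_cell lam \<mu> := sum_list lam)"
proof -
  let ?n = "sum_list lam"
  have T: "T \<in> extensional (young_diagram lam)" "bij_betw T (young_diagram lam) {1..?n}"
    "\<And>y z. y \<in> young_diagram lam \<Longrightarrow> z \<in> young_diagram lam \<Longrightarrow> precedes y z \<Longrightarrow> T y < T z"
    using assms(3) by (auto simp: standard_tableaux_iff)
  have "?n \<in> T ` young_diagram lam" using T(2) assms(2) by (simp add: bij_betw_def)
  then obtain x where x: "x \<in> young_diagram lam" "T x = ?n" by auto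
  have top: "\<not> precedes x y" if "y \<in> young_diagram lam" for y
    using T(3)[OF x(1) that] bij_betwE[OF T(2)] that x(2) by fastforce
  obtain i c where xi: "x = (Suc i, c)" and c: "1 \<le> c" "c \<le> row lam i"
    using x(1) by (cases x; cases "fst x") (auto simp: mem_young_diagram_iff)
  have "\<not> Suc c \<le> row lam i"
    using top[of "(Suc i, Suc c)"] c by (auto simp: xi precedes_def mem_young_diagram_iff)
  then have "row lam i = c" using c by simp
  moreover have "\<not> c \<le> row lam (Suc i)"
    using top[of "(Suc (Suc i), c)"] c by (auto simp: xi precedes_def mem_young_diagram_iff)
  ultimately have "i \<in> removable_rows lam" by (simp add: removable_rows_def)
  then have "i \<in> cover_row lam ` down_covers lam"
    using bij_betw_down_covers[OF assms(1)] by (simp add: bij_betw_def)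
  then obtain \<mu> where mu: "\<mu> \<lessdot> lam" "cover_row lam \<mu> = i"
    by (auto simp: down_covers_def)
  have sk: "skew_cell lam \<mu> = x"
    using cover_row(2)[OF mu(1)] mu(2) \<open>row lam i = c\<close> xi by simp
  have D: "young_diagram \<mu> = young_diagram lam - {x}"
    using skew_cell_eq[OF mu(1)] mu(1) by (auto simp: covered_by_def sk)
  have n: "?n = Suc (sum_list \<mu>)" using covered_by_sum_list[OF mu(1)] by simp
  \<comment> \<open>extensionality on the smaller diagram forces the default value at the removed cell\<close>
  let ?S = "T(x := undefined)"
  have "bij_betw T (young_diagram \<mu>) {1..sum_list \<mu>}"
  proof -
    have "T ` (young_diagram lam - {x}) = {1..?n} - {T x}"
      using T(2) x(1) inj_on_image_set_diff[of T "young_diagram lam" "young_diagram lam" "{x}"]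
      by (simp add: bij_betw_def)
    then have "bij_betw T (young_diagram lam - {x}) ({1..?n} - {T x})"
      by (intro bij_betw_subset[OF T(2)]) auto
    moreover have "{1..?n} - {T x} = {1..sum_list \<mu>}" using x(2) n by auto
    ultimately show ?thesis by (simp add: D)
  qed
  then have "bij_betw ?S (young_diagram \<mu>) {1..sum_list \<mu>}"
    by (subst bij_betw_cong[of _ _ T]) (auto simp: D)
  moreover have "?S \<in> extensional (young_diagram \<mu>)" using T(1) by (auto simp: extensional_def D)
  ultimately have "?S \<in> standard_tableaux \<mu>" using T(3) by (auto simp: standard_tableaux_iff D)
  moreover have "T = ?S(skew_cell lam \<mu> := ?n)" using x(2) by (auto simp: sk)
  ultimately show ?thesis by (rule that[OF mu(1)])
qed

lemma num_SYT_branching: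
  assumes "is_partition lam" "1 \<le> sum_list lam"
  shows "num_SYT lam = (\<Sum>\<mu>\<in>down_covers lam. num_SYT \<mu>)"
proof -
  let ?n = "sum_list lam"
  let ?f = "\<lambda>(\<mu>, S). S(skew_cell lam \<mu> := ?n)"
  let ?D = "SIGMA \<mu>:down_covers lam. standard_tableaux \<mu>"
  have "bij_betw ?f ?D (standard_tableaux lam)"
  proof (rule bij_betw_imageI)
    show "inj_on ?f ?D"
    proof (rule inj_onI, clarsimp)
      fix \<mu> S \<mu>' S'
      assume h: "\<mu> \<in> down_covers lam" "S \<in> standard_tableaux \<mu>"
        "\<mu>' \<in> down_covers lam" "S' \<in> standard_tableaux \<mu>'"
        and eq: "S(skew_cell lam \<mu> := ?n) = S'(skew_cell lam \<mu>' := ?n)"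
      let ?x = "skew_cell lam \<mu>" and ?x' = "skew_cell lam \<mu>'"
      let ?T = "S(?x := ?n)"
      have c: "\<mu> \<lessdot> lam" "\<mu>' \<lessdot> lam" using h by (auto simp: down_covers_def)
      have "inj_on ?T (young_diagram lam)"
        using extend_standard_tableau[OF c(1) h(2)] by (simp add: standard_tableaux_iff bij_betw_def)
      moreover have "?x \<in> young_diagram lam" "?x' \<in> young_diagram lam"
        using skew_cell_eq c by blast+
      moreover have "?T ?x = ?T ?x'" using fun_cong[OF eq, of ?x'] by simp
      ultimately have xx: "?x = ?x'" by (simp only: inj_on_eq_iff)
      then have "cover_row lam \<mu> = cover_row lam \<mu>'" by (simp add: cover_row_def)
      then have mm: "\<mu> = \<mu>'"
        using bij_betw_down_covers[OF assms(1)] h by (auto simp: bij_betw_def dest: inj_onD)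
      have "?x \<notin> young_diagram \<mu>" using skew_cell_eq[OF c(1)] by blast
      then have "S ?x = undefined" "S' ?x = undefined"
        using h mm by (auto simp: standard_tableaux_iff intro: extensional_arb)
      then have "S y = S' y" for y using fun_cong[OF eq, of y] xx by (cases "y = ?x") auto
      then show "\<mu> = \<mu>' \<and> S = S'" using mm by auto
    qed
    show "?f ` ?D = standard_tableaux lam"
    proof (intro equalityI subsetI)
      fix T assume "T \<in> ?f ` ?D"
      then show "T \<in> standard_tableaux lam"
        using extend_standard_tableau by (auto simp: down_covers_def)
    next
      fix T assume "T \<in> standard_tableaux lam"
      then obtain \<mu> S where "\<mu> \<lessdot> lam" "S \<in> standard_tableaux \<mu>"
        "T = S(skew_cell lam \<mu> := ?n)"
        by (rule restrict_standard_tableau[OF assms])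
      then show "T \<in> ?f ` ?D" by (force simp: down_covers_def)
    qed
  qed
  then have "card (standard_tableaux lam) = card ?D" by (simp add: bij_betw_same_card)
  then show ?thesis
    by (simp add: num_SYT_def finite_down_covers finite_standard_tableaux)
qed

section \<open>The product formula for the number of tableaux\<close>

text \<open>With \<open>k\<close> rows, zero rows included, these are the distinct numbers \<open>l\<^sub>i = \<kappa>\<^sub>i + k - i\<close> (rows from 1)
  of Frobenius' formula.\<close>

definition shifted_row :: "nat \<Rightarrow> nat list \<Rightarrow> nat \<Rightarrow> nat" where
  "shifted_row k \<kappa> i = row \<kappa> i + (k - 1 - i)"

text \<open>The Vandermonde product.\<close>

definition difference_product :: "nat \<Rightarrow> (nat \<Rightarrow> real) \<Rightarrow> real" where
  "difference_product k l = (\<Prod>(a, b)\<in>{(a, b). a < b \<and> b < k}. l a - l b)"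

text \<open>Equal to the number of tableaux. The lemmas below need only that both satisfy the same
  branching rule, so they establish proportionality for fixed \<open>k\<close>; the constant is the value
  at the empty partition and cancels from all ratios.\<close>

definition frobenius_product :: "nat \<Rightarrow> nat list \<Rightarrow> real" where
  "frobenius_product k \<kappa> = fact (sum_list \<kappa>) * difference_product k (\<lambda>i. real (shifted_row k \<kappa> i))
     / (\<Prod>i<k. fact (shifted_row k \<kappa> i))"

lemma finite_index_pairs: "finite {(a, b). a < b \<and> b < (k::nat)}"
  by (rule finite_subset[of _ "{..<k} \<times> {..<k}"]) auto

lemma difference_product_nonzero:
  assumes "inj_on l {..<k}"
  shows "difference_product k l \<noteq> 0"
  using assms unfolding difference_product_def
  by (subst prod_zero_iff[OF finite_index_pairs]) (auto simp: inj_on_def)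

text \<open>Exactly the pairs containing \<open>i\<close> change, and each index \<open>j \<noteq> i\<close> occurs in one of them; swapping
  the members of a pair does not affect the quotient of differences.\<close>

lemma difference_product_update:
  assumes "i < k" "inj_on l {..<k}"
  shows "difference_product k (l(i := z))
    = difference_product k l * (\<Prod>j\<in>{..<k} - {i}. (z - l j) / (l i - l j))"
proof -
  let ?P = "{(a, b). a < b \<and> b < k}"
  let ?l = "l(i := z)"
  let ?g = "\<lambda>(a, b). (?l a - ?l b) / (l a - l b)"
  have ne: "l a \<noteq> l b" if "a < b" "b < k" for a b using assms(2) that by (auto simp: inj_on_def)
  have ratio: "(z - l j) / (l i - l j) = (l j - z) / (l j - l i)" for j
    by (metis minus_diff_eq minus_divide_divide)
  have "(\<Prod>j\<in>{..<k} - {i}. (z - l j) / (l i - l j)) = prod ?g ?P"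
  proof (rule prod.reindex_bij_witness_not_neutral[where S' = "{}" and T' = "{(a, b)\<in>?P. a \<noteq> i \<and> b \<noteq> i}"
      and j = "\<lambda>j. (min i j, max i j)" and i = "\<lambda>(a, b). if a = i then b else a"])
    show "finite {(a, b) \<in> ?P. a \<noteq> i \<and> b \<noteq> i}" by (rule finite_subset[OF _ finite_index_pairs]) auto
    show "?g (min i j, max i j) = (z - l j) / (l i - l j)" if "j \<in> {..<k} - {i}" for j
      using that ratio[of j] by (auto simp: min_def max_def)
  qed (use assms(1) ne in \<open>auto simp: min_def max_def split: if_splits\<close>)
  moreover have "difference_product k ?l = difference_product k l * prod ?g ?P"
    unfolding difference_product_def prod.distrib[symmetric]
    by (intro prod.cong refl) (use ne in force)
  ultimately show ?thesis by simp
qed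

lemma shifted_row_strict_antimono:
  assumes "is_partition \<kappa>" "i < j" "j < k"
  shows "shifted_row k \<kappa> j < shifted_row k \<kappa> i"
  using row_antimono[OF assms(1), of i j] assms(2,3) by (simp add: shifted_row_def)

lemma inj_on_shifted_row:
  assumes "is_partition \<kappa>"
  shows "inj_on (\<lambda>i. real (shifted_row k \<kappa> i)) {..<k}"
  by (rule inj_onI)
    (metis assms lessThan_iff linorder_neqE_nat nat_less_le of_nat_eq_iff shifted_row_strict_antimono)

lemma frobenius_product_nonzero: "is_partition \<kappa> \<Longrightarrow> frobenius_product k \<kappa> \<noteq> 0"
  by (simp add: frobenius_product_def difference_product_nonzero inj_on_shifted_row)

lemma shifted_row_cover:
  assumes "\<mu> \<lessdot> lam"
  shows "shifted_row k lam = (shifted_row k \<mu>)(cover_row lam \<mu> := Suc (shifted_row k \<mu> (cover_row lam \<mu>)))"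
  using cover_row(1)[OF assms] by (auto simp: fun_eq_iff shifted_row_def)

lemma frobenius_product_cover:
  assumes "\<mu> \<lessdot> lam" "length lam \<le> k"
  shows "frobenius_product k \<mu> = frobenius_product k lam
    * removal_weight (\<lambda>i. real (shifted_row k lam i)) {..<k} (cover_row lam \<mu>) / real (sum_list lam)"
proof -
  let ?i = "cover_row lam \<mu>"
  let ?b = "shifted_row k lam"
  let ?c = "shifted_row k \<mu>"
  let ?l = "\<lambda>i. real (?b i)"
  have part: "is_partition lam" using assms by (simp add: covered_by_def)
  have i: "?i < k" using cover_row_less_length[OF assms(1)] assms(2) by simp
  have b: "?b = ?c(?i := Suc (?c ?i))" by (rule shifted_row_cover[OF assms(1)])
  have bi: "?b ?i = Suc (?c ?i)" using fun_cong[OF b, of ?i] by simp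
  have bj: "?b j = ?c j" if "j \<noteq> ?i" for j using fun_cong[OF b, of j] that by simp
  have "(\<lambda>i. real (?c i)) = ?l(?i := ?l ?i - 1)" using bi bj by auto
  then have V: "difference_product k (\<lambda>i. real (?c i))
      = difference_product k ?l * (\<Prod>j\<in>{..<k} - {?i}. (?l ?i - 1 - ?l j) / (?l ?i - ?l j))"
    using difference_product_update[OF i inj_on_shifted_row[OF part], of "?l ?i - 1"] by simp
  have "(\<Prod>j\<in>{..<k} - {?i}. fact (?b j)) = (\<Prod>j\<in>{..<k} - {?i}. fact (?c j) :: real)"
    by (intro prod.cong) (auto simp: bj)
  then have denominators: "(\<Prod>j<k. fact (?b j) :: real) = ?l ?i * (\<Prod>j<k. fact (?c j))"
    using i by (simp add: prod.remove[of "{..<k}" ?i] bi)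
  have factorial: "fact (sum_list lam) = real (sum_list lam) * fact (sum_list \<mu>)"
    using covered_by_sum_list[OF assms(1)] by simp
  have nz: "?l ?i \<noteq> 0" "real (sum_list lam) \<noteq> 0"
    using bi covered_by_sum_list[OF assms(1)] by auto
  have "g * (d * p) / c = N * g * d / (L * c) * (L * p) / N"
    if "L \<noteq> 0" "N \<noteq> 0" for g d p c N L :: real
    using that by simp
  from this[OF nz] show ?thesis
    unfolding frobenius_product_def V removal_weight_def denominators factorial .
qed

text \<open>A row that cannot be shortened is as long as the next one, which makes a factor
  \<open>l i - 1 - l (i + 1)\<close> vanish, or it is the empty last row with \<open>l i = 0\<close>. Hence sums over covers
  extend to sums over all rows.\<close>

lemma removal_weight_nonremovable:
  assumes "is_partition lam" "i < k" "length lam \<le> k" "i \<notin> removable_rows lam"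
  shows "removal_weight (\<lambda>i. real (shifted_row k lam i)) {..<k} i = 0"
proof -
  have eq: "row lam (Suc i) = row lam i"
    using assms row_antimono[OF assms(1), of i "Suc i"] by (auto simp: removable_rows_def)
  show ?thesis
  proof (cases "Suc i < k")
    case True
    then have "real (shifted_row k lam i) - 1 - real (shifted_row k lam (Suc i)) = 0"
      using eq by (simp add: shifted_row_def of_nat_diff)
    then show ?thesis unfolding removal_weight_def using True
      by (auto intro!: prod_zero bexI[of _ "Suc i"])
  next
    case False
    then have "row lam i = 0" using assms eq by (simp add: row_def)
    then show ?thesis using False by (simp add: removal_weight_def shifted_row_def)
  qed
qed

lemma addition_weight_nonaddable:
  assumes "is_partition lam" "i < k" "i \<notin> addable_rows lam"
  shows "addition_weight (\<lambda>i. real (shifted_row k lam i)) {..<k} i = 0"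
proof -
  have i: "i > 0" "row lam (i - 1) = row lam i"
    using assms row_antimono[OF assms(1), of "i - 1" i] by (auto simp: addable_rows_def)
  then have "real (shifted_row k lam i) + 1 - real (shifted_row k lam (i - 1)) = 0"
    using assms(2) by (simp add: shifted_row_def of_nat_diff)
  then show ?thesis unfolding addition_weight_def using i assms(2)
    by (auto intro!: prod_zero bexI[of _ "i - 1"])
qed

lemma removable_rows_less:
  assumes "length lam \<le> k"
  shows "removable_rows lam \<subseteq> {..<k}"
  using assms by (auto simp: removable_rows_def row_def split: if_splits)

lemma addable_rows_less:
  assumes "length lam < k"
  shows "addable_rows lam \<subseteq> {..<k}"
  using assms by (auto simp: addable_rows_def row_def split: if_splits)

lemma sum_down_covers:
  assumes "is_partition lam" "length lam \<le> k"
  shows "(\<Sum>\<mu>\<in>down_covers lam. removal_weight (\<lambda>i. real (shifted_row k lam i)) {..<k} (cover_row lam \<mu>)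
        * g (cover_row lam \<mu>))
    = (\<Sum>j<k. removal_weight (\<lambda>i. real (shifted_row k lam i)) {..<k} j * g j)"
proof -
  have "(\<Sum>\<mu>\<in>down_covers lam. removal_weight (\<lambda>i. real (shifted_row k lam i)) {..<k} (cover_row lam \<mu>)
        * g (cover_row lam \<mu>))
    = (\<Sum>j\<in>removable_rows lam. removal_weight (\<lambda>i. real (shifted_row k lam i)) {..<k} j * g j)"
    by (rule sum.reindex_bij_betw[OF bij_betw_down_covers[OF assms(1)]])
  also have "\<dots> = (\<Sum>j<k. removal_weight (\<lambda>i. real (shifted_row k lam i)) {..<k} j * g j)"
    using removable_rows_less[OF assms(2)] removal_weight_nonremovable assms
    by (intro sum.mono_neutral_left) auto
  finally show ?thesis .
qed

lemma sum_up_covers: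
  assumes "is_partition lam" "length lam < k"
  shows "(\<Sum>\<nu>\<in>up_covers lam. addition_weight (\<lambda>i. real (shifted_row k lam i)) {..<k} (cover_row \<nu> lam)
        * g (cover_row \<nu> lam))
    = (\<Sum>i<k. addition_weight (\<lambda>i. real (shifted_row k lam i)) {..<k} i * g i)"
proof -
  have "(\<Sum>\<nu>\<in>up_covers lam. addition_weight (\<lambda>i. real (shifted_row k lam i)) {..<k} (cover_row \<nu> lam)
        * g (cover_row \<nu> lam))
    = (\<Sum>i\<in>addable_rows lam. addition_weight (\<lambda>i. real (shifted_row k lam i)) {..<k} i * g i)"
    by (rule sum.reindex_bij_betw[OF bij_betw_up_covers[OF assms(1)]])
  also have "\<dots> = (\<Sum>i<k. addition_weight (\<lambda>i. real (shifted_row k lam i)) {..<k} i * g i)"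
    using addable_rows_less[OF assms(2)] addition_weight_nonaddable assms
    by (intro sum.mono_neutral_left) auto
  finally show ?thesis .
qed

text \<open>Every removal multiplies the product by its weight over \<open>n\<close>, and the weights sum to
  \<open>(\<Sum>i<k. l i) - k (k - 1) / 2 = n\<close>.\<close>

lemma frobenius_product_branching:
  assumes "is_partition lam" "length lam \<le> k" "1 \<le> sum_list lam"
  shows "frobenius_product k lam = (\<Sum>\<mu>\<in>down_covers lam. frobenius_product k \<mu>)"
proof -
  let ?l = "\<lambda>i. real (shifted_row k lam i)"
  let ?u = "removal_weight ?l {..<k}"
  have rev: "(\<Sum>i<k. real (k - 1 - i)) = real k * (real k - 1) / 2"
  proof -
    have "(\<Sum>i<k. real (k - 1 - i)) = (\<Sum>i<k. real i)"
      using sum.nat_diff_reindex[of real k] by simp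
    also have "\<dots> = real k * (real k - 1) / 2" by (induction k) (simp_all add: field_simps)
    finally show ?thesis .
  qed
  have "(\<Sum>i<k. ?l i) = real (\<Sum>i<k. row lam i) + (\<Sum>i<k. real (k - 1 - i))"
    by (simp only: shifted_row_def of_nat_add of_nat_sum sum.distrib)
  then have "(\<Sum>i<k. ?u i) = real (sum_list lam)"
    using sum_removal_weight[OF _ inj_on_shifted_row[OF assms(1), of k]] rev sum_row[OF assms(2)] by simp
  then have "(\<Sum>\<mu>\<in>down_covers lam. ?u (cover_row lam \<mu>)) = real (sum_list lam)"
    using sum_down_covers[OF assms(1,2), of "\<lambda>_. 1"] by simp
  moreover have "(\<Sum>\<mu>\<in>down_covers lam. frobenius_product k \<mu>)
      = (\<Sum>\<mu>\<in>down_covers lam. ?u (cover_row lam \<mu>)) * (frobenius_product k lam / real (sum_list lam))"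
    unfolding sum_distrib_right
    using assms(2) by (intro sum.cong refl) (simp add: frobenius_product_cover down_covers_def)
  moreover have "real (sum_list lam) \<noteq> 0" using assms(3) by linarith
  ultimately show ?thesis by (simp del: sum_list_eq_0_iff of_nat_eq_0_iff)
qed

lemma length_down_cover:
  assumes "\<mu> \<lessdot> lam" shows "length \<mu> \<le> length lam"
proof -
  have "row \<mu> (length lam) = 0"
    using fun_cong[OF cover_row(1)[OF assms], of "length lam"] by (simp add: row_def split: if_splits)
  then show ?thesis using assms by (simp add: row_eq_0_iff covered_by_def)
qed

lemma length_up_cover:
  assumes "lam \<lessdot> \<nu>" shows "length \<nu> \<le> Suc (length lam)"
proof -
  have "cover_row \<nu> lam \<in> addable_rows lam"
    using bij_betw_up_covers assms by (metis bij_betwE covered_by_def mem_Collect_eq up_covers_def)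
  then have "cover_row \<nu> lam < Suc (length lam)" using addable_rows_less[of lam] by blast
  then have "row \<nu> (Suc (length lam)) = 0"
    using fun_cong[OF cover_row(1)[OF assms], of "Suc (length lam)"] by (simp add: row_def)
  then show ?thesis using assms by (simp add: row_eq_0_iff covered_by_def)
qed

lemma num_SYT_frobenius:
  assumes "is_partition lam" "length lam \<le> k"
  shows "real (num_SYT lam) * frobenius_product k [] = frobenius_product k lam"
  using assms
proof (induction "sum_list lam" arbitrary: lam)
  case 0
  then have "lam = []" by (cases lam) (auto simp: is_partition_def)
  then show ?case by (simp add: num_SYT_Nil)
next
  case (Suc n)
  have IH: "real (num_SYT \<mu>) * frobenius_product k [] = frobenius_product k \<mu>"
    if "\<mu> \<in> down_covers lam" for \<mu>
  proof -
    have c: "\<mu> \<lessdot> lam" using that by (simp add: down_covers_def)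
    show ?thesis
      using covered_by_sum_list[OF c] length_down_cover[OF c] c Suc by (simp add: covered_by_def)
  qed
  have n: "1 \<le> sum_list lam" using Suc.hyps by simp
  show ?case
    unfolding num_SYT_branching[OF Suc.prems(1) n] frobenius_product_branching[OF Suc.prems n]
    by (simp add: sum_distrib_right IH)
qed

section \<open>Ratios of numbers of tableaux, and the two sums\<close>

lemma num_SYT_down_cover:
  assumes "\<mu> \<lessdot> lam" "length lam \<le> k"
  shows "real (num_SYT \<mu>) = real (num_SYT lam)
    * removal_weight (\<lambda>i. real (shifted_row k lam i)) {..<k} (cover_row lam \<mu>) / real (sum_list lam)"
proof -
  have part: "is_partition \<mu>" "is_partition lam" using assms by (auto simp: covered_by_def)
  have "real (num_SYT \<mu>) * frobenius_product k [] = real (num_SYT lam) * frobenius_product k []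
    * removal_weight (\<lambda>i. real (shifted_row k lam i)) {..<k} (cover_row lam \<mu>) / real (sum_list lam)"
    using num_SYT_frobenius[of \<mu> k] num_SYT_frobenius[of lam k] part assms(2)
      length_down_cover[OF assms(1)] frobenius_product_cover[OF assms] by simp
  moreover have "frobenius_product k [] \<noteq> 0"
    by (rule frobenius_product_nonzero) (simp add: is_partition_def)
  moreover have "real (sum_list lam) \<noteq> 0" using covered_by_sum_list[OF assms(1)] by simp
  ultimately show ?thesis by (simp add: field_simps)
qed

text \<open>Removing the cell just added undoes its addition; this transfers the ratio for removals to
  additions.\<close>

lemma removal_weight_after_addition:
  assumes "i \<in> I" "l i + 1 \<noteq> 0" "\<And>j. j \<in> I \<Longrightarrow> l i + 1 \<noteq> l j" "inj_on l I" "finite I"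
  shows "removal_weight (l(i := l i + 1)) I i * addition_weight l I i = 1"
proof -
  have "removal_weight (l(i := l i + 1)) I i
      = (l i + 1) * (\<Prod>j\<in>I - {i}. (l i - l j) / (l i + 1 - l j))"
    unfolding removal_weight_def by (auto intro!: prod.cong)
  moreover have "(\<Prod>j\<in>I - {i}. l i - l j) \<noteq> 0" "(\<Prod>j\<in>I - {i}. l i + 1 - l j) \<noteq> 0"
    using assms by (auto simp: inj_on_def)
  ultimately show ?thesis using assms(2) by (simp add: addition_weight_def prod_dividef)
qed

lemma addable_Suc_shifted_row_neq:
  assumes "is_partition lam" "i \<in> addable_rows lam" "i < k" "j < k"
  shows "real (shifted_row k lam i) + 1 \<noteq> real (shifted_row k lam j)"
proof (cases "j < i")
  case True
  then have "j \<le> i - 1" by simp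
  then have "row lam i < row lam j"
    using True assms(2) row_antimono[OF assms(1) \<open>j \<le> i - 1\<close>] by (simp add: addable_rows_def)
  then have "shifted_row k lam i + 1 < shifted_row k lam j"
    using True assms(3) by (simp add: shifted_row_def)
  then show ?thesis by linarith
next
  case False
  then have "shifted_row k lam j \<le> shifted_row k lam i"
    using shifted_row_strict_antimono[OF assms(1), of i j k] assms(4) by (cases "i = j") auto
  then show ?thesis by linarith
qed

lemma removable_Suc_shifted_row_neq:
  assumes "is_partition lam" "j \<in> removable_rows lam" "i < k" "j < k"
  shows "real (shifted_row k lam i) + 1 \<noteq> real (shifted_row k lam j)"
proof (cases "j < i")
  case True
  then have "row lam i < row lam j"
    using assms(2) row_antimono[OF assms(1), of "Suc j" i] by (auto simp: removable_rows_def)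
  then have "shifted_row k lam i + 1 < shifted_row k lam j"
    using True assms(3) by (simp add: shifted_row_def)
  then show ?thesis by linarith
next
  case False
  then have "shifted_row k lam j \<le> shifted_row k lam i"
    using shifted_row_strict_antimono[OF assms(1), of i j k] assms(4) by (cases "i = j") auto
  then show ?thesis by linarith
qed

lemma num_SYT_up_cover:
  assumes "lam \<lessdot> \<nu>" "length lam < k"
  shows "real (num_SYT \<nu>) = real (sum_list lam + 1) * real (num_SYT lam)
    * addition_weight (\<lambda>i. real (shifted_row k lam i)) {..<k} (cover_row \<nu> lam)"
proof -
  let ?i = "cover_row \<nu> lam"
  let ?l = "\<lambda>i. real (shifted_row k lam i)"
  have part: "is_partition lam" using assms by (simp add: covered_by_def)
  have len: "length \<nu> \<le> k" using length_up_cover[OF assms(1)] assms(2) by simp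
  have add: "?i \<in> addable_rows lam"
    using bij_betw_up_covers[OF part] assms by (metis bij_betwE mem_Collect_eq up_covers_def)
  then have i: "?i < k" using addable_rows_less[OF assms(2)] by auto
  have "(\<lambda>i. real (shifted_row k \<nu> i)) = ?l(?i := ?l ?i + 1)"
    unfolding shifted_row_cover[OF assms(1), of k] by auto
  then have "real (num_SYT lam) = real (num_SYT \<nu>)
      * removal_weight (?l(?i := ?l ?i + 1)) {..<k} ?i / real (sum_list lam + 1)"
    using num_SYT_down_cover[OF assms(1) len] covered_by_sum_list[OF assms(1)] by simp
  moreover have "removal_weight (?l(?i := ?l ?i + 1)) {..<k} ?i * addition_weight ?l {..<k} ?i = 1"
    using i addable_Suc_shifted_row_neq[OF part add i] inj_on_shifted_row[OF part, of k]
    by (intro removal_weight_after_addition) auto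
  ultimately show ?thesis by (simp add: mult.assoc)
qed

lemma hook_length_shifted_rows:
  assumes "\<mu> \<in> down_covers lam" "\<nu> \<in> up_covers lam" "length lam < k"
  shows "(real (hook_length lam (crossing_cell lam \<mu> \<nu>)))\<^sup>2
    = (real (shifted_row k lam (cover_row \<nu> lam)) + 1 - real (shifted_row k lam (cover_row lam \<mu>)))\<^sup>2"
proof -
  let ?i = "cover_row \<nu> lam" and ?j = "cover_row lam \<mu>"
  have mu: "\<mu> \<lessdot> lam" and nu: "lam \<lessdot> \<nu>"
    using assms(1,2) by (simp_all add: down_covers_def up_covers_def)
  have "?j < k" using cover_row_less_length[OF mu] assms(3) by simp
  moreover have "?i < k" using cover_row_less_length[OF nu] length_up_cover[OF nu] assms(3) by simp
  ultimately have e: "(int (row lam ?i) + 1 - int ?i) - (int (row lam ?j) - int ?j)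
      = int (shifted_row k lam ?i) + 1 - int (shifted_row k lam ?j)"
    by (simp add: shifted_row_def of_nat_diff)
  have "real (hook_length lam (crossing_cell lam \<mu> \<nu>))
      = of_int (int (hook_length lam (crossing_cell lam \<mu> \<nu>)))" by simp
  also have "\<dots> = \<bar>real (shifted_row k lam ?i) + 1 - real (shifted_row k lam ?j)\<bar>"
    unfolding hook_length_crossing_cell[OF assms(1,2)] e by simp
  finally show ?thesis by simp
qed

theorem mainTheorem3:
  fixes n :: nat and lam :: "nat list"
  assumes "n \<ge> 1" and "partition_of lam n"
  shows "(\<forall>\<mu> \<in> down_covers lam.
            (\<Sum>\<nu> \<in> up_covers lam.
               real (num_SYT \<mu>) * real (num_SYT \<nu>)
                 / (real (hook_length lam (crossing_cell lam \<mu> \<nu>)))\<^sup>2)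
            = (real n + 1) / real n * (real (num_SYT lam))\<^sup>2) \<and>
         (\<forall>\<nu> \<in> up_covers lam.
            real (num_SYT lam) * real (num_SYT \<nu>) / real n +
            (\<Sum>\<mu> \<in> down_covers lam.
               real (num_SYT \<mu>) * real (num_SYT \<nu>)
                 / (real (hook_length lam (crossing_cell lam \<mu> \<nu>)))\<^sup>2)
            = (real n + 1) / real n * (real (num_SYT lam))\<^sup>2)"
proof (intro conjI ballI)
  \<comment> \<open>one empty row: a part can be added, and some \<open>l i\<close> is 0\<close>
  define k where "k = Suc (length lam)"
  define l where "l = (\<lambda>i. real (shifted_row k lam i))"
  let ?f = "\<lambda>\<kappa>. real (num_SYT \<kappa>)"
  let ?u = "removal_weight l {..<k}" and ?w = "addition_weight l {..<k}"
  have part: "is_partition lam" and n: "sum_list lam = n"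
    using assms(2) by (auto simp: partition_of_def)
  have k: "length lam \<le> k" "length lam < k" by (auto simp: k_def)
  have inj: "inj_on l {..<k}" unfolding l_def by (rule inj_on_shifted_row[OF part])
  have down: "?f \<mu> = ?f lam * ?u (cover_row lam \<mu>) / real n" if "\<mu> \<in> down_covers lam" for \<mu>
    using num_SYT_down_cover[of \<mu> lam k] that k n by (simp add: down_covers_def l_def)
  have up: "?f \<nu> = (real n + 1) * ?f lam * ?w (cover_row \<nu> lam)" if "\<nu> \<in> up_covers lam" for \<nu>
    using num_SYT_up_cover[of lam \<nu> k] that k n by (simp add: up_covers_def l_def)
  have hook: "(real (hook_length lam (crossing_cell lam \<mu> \<nu>)))\<^sup>2
      = (l (cover_row \<nu> lam) + 1 - l (cover_row lam \<mu>))\<^sup>2"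
    if "\<mu> \<in> down_covers lam" "\<nu> \<in> up_covers lam" for \<mu> \<nu>
    using hook_length_shifted_rows[OF that k(2)] by (simp add: l_def)
  have pos: "l i + 1 \<noteq> 0" for i unfolding l_def by linarith
  {
    fix \<mu> assume mu: "\<mu> \<in> down_covers lam"
    let ?j = "cover_row lam \<mu>"
    have j: "?j \<in> removable_rows lam"
      using bij_betw_down_covers[OF part] mu by (metis bij_betwE)
    then have jk: "?j < k" using removable_rows_less[OF k(1)] by auto
    have "l ?j \<noteq> 0" using j by (simp add: l_def shifted_row_def removable_rows_def)
    moreover have "l (length lam) = 0" by (simp add: l_def shifted_row_def k_def row_def)
    moreover have "l i + 1 \<noteq> l ?j" if "i < k" for i
      unfolding l_def by (rule removable_Suc_shifted_row_neq[OF part j that jk])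
    ultimately have key: "?u ?j * (\<Sum>i<k. ?w i / (l i + 1 - l ?j)\<^sup>2) = 1"
      using inj jk pos k(2) by (intro sum_addition_weight_over_square[where z = "length lam"]) auto
    have "(\<Sum>\<nu> \<in> up_covers lam. ?f \<mu> * ?f \<nu> / (real (hook_length lam (crossing_cell lam \<mu> \<nu>)))\<^sup>2)
        = (\<Sum>\<nu> \<in> up_covers lam. ?w (cover_row \<nu> lam) * (1 / (l (cover_row \<nu> lam) + 1 - l ?j)\<^sup>2))
          * (?f \<mu> * (real n + 1) * ?f lam)"
      unfolding sum_distrib_right by (intro sum.cong refl) (simp add: hook[OF mu] up)
    also have "(\<Sum>\<nu> \<in> up_covers lam. ?w (cover_row \<nu> lam) * (1 / (l (cover_row \<nu> lam) + 1 - l ?j)\<^sup>2))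
        = (\<Sum>i<k. ?w i / (l i + 1 - l ?j)\<^sup>2)"
      using sum_up_covers[OF part k(2), of "\<lambda>i. 1 / (l i + 1 - l ?j)\<^sup>2"] by (simp add: l_def)
    also have "\<dots> * (?f \<mu> * (real n + 1) * ?f lam)
        = (real n + 1) / real n * (?f lam)\<^sup>2 * (?u ?j * (\<Sum>i<k. ?w i / (l i + 1 - l ?j)\<^sup>2))"
      by (simp add: down[OF mu] power2_eq_square)
    finally show "(\<Sum>\<nu> \<in> up_covers lam.
        ?f \<mu> * ?f \<nu> / (real (hook_length lam (crossing_cell lam \<mu> \<nu>)))\<^sup>2)
      = (real n + 1) / real n * (?f lam)\<^sup>2" unfolding key by simp
  next
    fix \<nu> assume nu: "\<nu> \<in> up_covers lam"
    let ?i = "cover_row \<nu> lam"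
    have i: "?i \<in> addable_rows lam"
      using bij_betw_up_covers[OF part] nu by (metis bij_betwE)
    then have ik: "?i < k" using addable_rows_less[OF k(2)] by auto
    have "l ?i + 1 \<noteq> l j" if "j < k" for j
      unfolding l_def by (rule addable_Suc_shifted_row_neq[OF part i ik that])
    then have key: "?w ?i * (1 + (\<Sum>j<k. ?u j / (l ?i + 1 - l j)\<^sup>2)) = 1"
      using inj ik pos by (intro sum_removal_weight_over_square) auto
    have "(\<Sum>\<mu> \<in> down_covers lam. ?f \<mu> * ?f \<nu> / (real (hook_length lam (crossing_cell lam \<mu> \<nu>)))\<^sup>2)
        = (\<Sum>\<mu> \<in> down_covers lam. ?u (cover_row lam \<mu>) * (1 / (l ?i + 1 - l (cover_row lam \<mu>))\<^sup>2))
          * (?f lam * ?f \<nu> / real n)"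
      unfolding sum_distrib_right by (intro sum.cong refl) (simp add: hook[OF _ nu] down mult_ac)
    also have "(\<Sum>\<mu> \<in> down_covers lam. ?u (cover_row lam \<mu>) * (1 / (l ?i + 1 - l (cover_row lam \<mu>))\<^sup>2))
        = (\<Sum>j<k. ?u j / (l ?i + 1 - l j)\<^sup>2)"
      using sum_down_covers[OF part k(1), of "\<lambda>j. 1 / (l ?i + 1 - l j)\<^sup>2"] by (simp add: l_def)
    finally have "?f lam * ?f \<nu> / real n
        + (\<Sum>\<mu> \<in> down_covers lam. ?f \<mu> * ?f \<nu> / (real (hook_length lam (crossing_cell lam \<mu> \<nu>)))\<^sup>2)
      = (1 + (\<Sum>j<k. ?u j / (l ?i + 1 - l j)\<^sup>2)) * (?f lam * ?f \<nu> / real n)"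
      by (simp only: distrib_right mult_1_left)
    also have "\<dots> = (real n + 1) / real n * (?f lam)\<^sup>2
        * (?w ?i * (1 + (\<Sum>j<k. ?u j / (l ?i + 1 - l j)\<^sup>2)))"
      by (simp add: up[OF nu] power2_eq_square)
    finally show "?f lam * ?f \<nu> / real n
        + (\<Sum>\<mu> \<in> down_covers lam. ?f \<mu> * ?f \<nu> / (real (hook_length lam (crossing_cell lam \<mu> \<nu>)))\<^sup>2)
      = (real n + 1) / real n * (?f lam)\<^sup>2" unfolding key by simp
  }
qed

end
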